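(* Let $\alpha\in(0,1)$ be an irrational number with partial quotients $(a_n)$ and convergents $p_n/q_n$, and suppose that there are $\beta>1$ and a strictly increasing sequence of positive integers $(t_k)_{k\ge1}$ such that, for all $k$, $$q_{t_k}\text{ is odd},\quad p_{t_{2k}}\text{ is even},\quad p_{t_{2k+1}}\text{ is odd},\quad a_{t_k+1}\ge k^\beta .$$ Let $\psi=(\varphi^1,\varphi^2):\mathbb{T}^1\to\mathbb{R}^2$ with $$\varphi^1=1_{[0,\frac{\alpha}{2}]}-1_{[\frac12,\frac12+\frac{\alpha}{2}]},\qquad \varphi^2=1_{[0,\frac12-\frac{\alpha}{2}]}-1_{[\frac12,1-\frac{\alpha}{2}]}.$$ Then, for $L_N=\sum_{k=1}^N q_{t_k}$, the sequence $(N^{-1/2}\psi_{L_N})_{N\ge1}$, where $\psi_{L}(x)=\sum_{j=0}^{L-1}\psi(x+j\alpha)$, satisfies a $2$-dimensional central limit theorem: it converges in distribution (with respect to Lebesgue measure on $\mathbb{T}^1$) to the centered Gaussian law on $\mathbb{R}^2$ with non-degenerate diagonal covariance matrix $$\begin{pmatrix}\frac12&0\\0&\frac12\end{pmatrix}.$$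
   Context: Continued fractions: $\alpha=[0;a_1,a_2,\dots]$ and $p_n/q_n$ are its convergents, with $p_{-1}=1$, $p_0=0$, $q_{-1}=0$, $q_0=1$, $q_{n+1}=a_{n+1}q_n+q_{n-1}$, $p_{n+1}=a_{n+1}p_n+p_{n-1}$. $\mathbb{T}^1=\mathbb{R}/\mathbb{Z}$ is identified with $[0,1)$, arguments of functions are taken modulo $1$, and $\mathbb{T}^1$ carries the Lebesgue (uniform) probability measure. *)

theory Defs
  imports "HOL-Probability.Probability"
begin

section \<open>Continued fractions\<close>

text \<open>
  For irrational \<open>\<alpha>\<close> in \<open>(0,1)\<close>, \<open>cf_remainder \<alpha> n = [0; a\<^sub>n\<^sub>+\<^sub>1, a\<^sub>n\<^sub>+\<^sub>2, \<dots>]\<close> is the \<open>n\<close>-th iterate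
  of the Gauss map \<open>x \<mapsto> frac (1/x)\<close> at \<open>\<alpha>\<close>, and \<open>a\<^sub>n\<close> is the integer part of \<open>1 / cf_remainder \<alpha> (n - 1)\<close>.
  The value at index 0 is the integer part of \<open>\<alpha>\<close>, which is \<open>0\<close> in the case of interest.
\<close>

primrec cf_remainder :: "real \<Rightarrow> nat \<Rightarrow> real" where
  "cf_remainder \<alpha> 0 = frac \<alpha>"
| "cf_remainder \<alpha> (Suc n) = frac (1 / cf_remainder \<alpha> n)"

fun cf_quotient :: "real \<Rightarrow> nat \<Rightarrow> nat" where
  "cf_quotient \<alpha> 0 = nat \<lfloor>\<alpha>\<rfloor>"
| "cf_quotient \<alpha> (Suc n) = nat \<lfloor>1 / cf_remainder \<alpha> n\<rfloor>"

text \<open>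
  Numerators and denominators of the convergents of \<open>[0; a\<^sub>1, a\<^sub>2, \<dots>]\<close>. The initial values at index
  \<open>-1\<close> (\<open>1\<close> for the numerator and \<open>0\<close> for the denominator) are eliminated from the recursion, which
  gives \<open>a\<^sub>1 * 0 + 1 = 1\<close> and \<open>a\<^sub>1 * 1 + 0 = a\<^sub>1\<close> at index 1.
\<close>

fun cf_numerator :: "real \<Rightarrow> nat \<Rightarrow> nat" where
  "cf_numerator \<alpha> 0 = 0"
| "cf_numerator \<alpha> (Suc 0) = 1"
| "cf_numerator \<alpha> (Suc (Suc n)) =
     cf_quotient \<alpha> (Suc (Suc n)) * cf_numerator \<alpha> (Suc n) + cf_numerator \<alpha> n"

fun cf_denominator :: "real \<Rightarrow> nat \<Rightarrow> nat" where
  "cf_denominator \<alpha> 0 = 1"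
| "cf_denominator \<alpha> (Suc 0) = cf_quotient \<alpha> (Suc 0)"
| "cf_denominator \<alpha> (Suc (Suc n)) =
     cf_quotient \<alpha> (Suc (Suc n)) * cf_denominator \<alpha> (Suc n) + cf_denominator \<alpha> n"

section \<open>The circle and the cocycle\<close>

text \<open>
  The circle is identified with \<open>[0,1)\<close>; functions on it are represented by functions on the reals
  that reduce their argument modulo 1 with \<^const>\<open>frac\<close>.
\<close>

definition circle_measure :: "real measure" where
  "circle_measure = restrict_space lborel {0..<1}"

definition circle_indicator :: "real set \<Rightarrow> real \<Rightarrow> real" where
  "circle_indicator A x = indicator A (frac x)"

definition phi1 :: "real \<Rightarrow> real \<Rightarrow> real" where
  "phi1 \<alpha> x = circle_indicator {0..\<alpha>/2} x - circle_indicator {1/2..1/2 + \<alpha>/2} x"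

definition phi2 :: "real \<Rightarrow> real \<Rightarrow> real" where
  "phi2 \<alpha> x = circle_indicator {0..1/2 - \<alpha>/2} x - circle_indicator {1/2..1 - \<alpha>/2} x"

definition psi :: "real \<Rightarrow> real \<Rightarrow> real ^ 2" where
  "psi \<alpha> x = vector [phi1 \<alpha> x, phi2 \<alpha> x]"

definition rotation_sum :: "real \<Rightarrow> (real \<Rightarrow> 'a) \<Rightarrow> nat \<Rightarrow> real \<Rightarrow> 'a::comm_monoid_add" where
  "rotation_sum \<alpha> f L x = (\<Sum>j<L. f (x + real j * \<alpha>))"

section \<open>Convergence in distribution and Gaussian laws\<close>

text \<open>
  Weak convergence of (finite Borel) measures on a topological space; the library's
  \<^const>\<open>weak_conv_m\<close> is restricted to measures on the real line.
\<close>

definition weakly_converges ::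
    "(nat \<Rightarrow> 'a::topological_space measure) \<Rightarrow> 'a measure \<Rightarrow> bool" where
  "weakly_converges \<mu> \<nu> \<longleftrightarrow>
     (\<forall>f :: 'a \<Rightarrow> real. continuous_on UNIV f \<longrightarrow> bounded (range f) \<longrightarrow>
        (\<lambda>n. \<integral>x. f x \<partial>\<mu> n) \<longlonglongrightarrow> (\<integral>x. f x \<partial>\<nu>))"

definition converges_in_distribution ::
    "'a measure \<Rightarrow> (nat \<Rightarrow> 'a \<Rightarrow> 'b::topological_space) \<Rightarrow> 'b measure \<Rightarrow> bool" where
  "converges_in_distribution M X \<nu> \<longleftrightarrow>
     (\<forall>n. X n \<in> borel_measurable M) \<and> weakly_converges (\<lambda>n. distr M borel (X n)) \<nu>"

text \<open>
  The centered Gaussian law with covariance matrix \<open>C\<close>, given by its density; this is only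
  meaningful for symmetric positive definite (in particular non-degenerate) \<open>C\<close>.
\<close>

definition centered_gaussian :: "real ^ 'n ^ 'n \<Rightarrow> (real ^ 'n) measure" where
  "centered_gaussian C = density lborel
     (\<lambda>x. ennreal (exp (- (x \<bullet> (matrix_inv C *v x)) / 2) / sqrt ((2 * pi) ^ CARD('n) * det C)))"

end

theory Submission
  imports Defs
begin

text \<open>
  The sum \<open>\<psi>\<^bsub>L\<^sub>N\<^esub>\<close> splits into \<open>N\<close> blocks, the \<open>k\<close>-th of length \<open>q = q\<^bsub>t\<^sub>k\<^esub>\<close>. Within a block, replace
  \<open>\<alpha>\<close> by \<open>p/q\<close>, both in the rotation and in the lengths of the arcs. The rotated points then form a
  translate of the grid of step \<open>1/q\<close>, and Hermite's identity for \<open>\<Sum>\<^sub>j \<lfloor>y + j/q\<rfloor>\<close> evaluates the block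
  exactly (\<open>sum_floor_arc_difference\<close>): since \<open>q\<close> is odd, it is a square wave \<open>\<plusminus>1\<close> of frequency \<open>q\<close> in
  the first coordinate if \<open>p\<close> is odd, in the second if \<open>p\<close> is even, and \<open>0\<close> in the other one. Moving the
  end points changes the block by at most \<open>4 q\<^sup>2 \<bar>\<alpha> - p/q\<bar> \<le> 4 / a\<^bsub>t\<^sub>k+1\<^esub> \<le> 4 k\<^bsup>-\<beta>\<^esup>\<close> in \<open>L\<^sup>1\<close>
  (\<open>rotation_sum_arc_difference\<close>, \<open>cf_approximation\<close>). These errors are summable, so after division by
  \<open>\<surd>N\<close> they disappear.

  There remains a sum of square waves \<open>X\<^sub>k\<close> whose frequencies grow so fast that they are almost
  independent fair signs. A square wave changes sign under translation by half its period \<open>\<delta>\<close>, hence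
  \<open>2 \<integral> F X = \<integral> (F - F(\<cdot> + \<delta>)) X\<close> for periodic \<open>F\<close>, and if \<open>F\<close> depends only on the slower waves
  this is small because those rarely change over the distance \<open>\<delta>\<close>. Applied to the partial products of
  \<open>exp (i \<theta>\<^sub>k X\<^sub>k)\<close>, where \<open>\<theta>\<^sub>k\<close> is of order \<open>1/\<surd>N\<close>, this shows that each new wave multiplies the
  characteristic function by \<open>cos \<theta>\<^sub>k \<approx> exp (- \<theta>\<^sub>k\<^sup>2 / 2)\<close> (\<open>wave_char_step\<close>, \<open>wave_char_gaussian\<close>).
  Half of the waves belong to each coordinate, so the limit is \<open>exp (- (u\<^sub>1\<^sup>2 + u\<^sub>2\<^sup>2) / 4)\<close>, which is the
  characteristic function of the Gaussian law with covariance matrix \<open>diag(1/2, 1/2)\<close>.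

  Levy's continuity theorem in Euclidean space (\<open>levy_continuity_euclidean\<close>) turns this into
  weak convergence. It is deduced from the theorem on the line, which controls the tails of the
  coordinates, and from the Weierstrass approximation theorem.
\<close>

section \<open>Characteristic functions and weak convergence in Euclidean space\<close>

inductive trig_polynomial :: "('a::euclidean_space \<Rightarrow> complex) \<Rightarrow> bool" where
  wave: "trig_polynomial (\<lambda>x. c * iexp (u \<bullet> x))"
| add: "trig_polynomial f \<Longrightarrow> trig_polynomial g \<Longrightarrow> trig_polynomial (\<lambda>x. f x + g x)"

lemma trig_polynomial_const: "trig_polynomial (\<lambda>x. c)"
  using wave[of c 0] by simp

lemma trig_polynomial_wave_mult:
  assumes "trig_polynomial g"
  shows "trig_polynomial (\<lambda>x. c * iexp (u \<bullet> x) * g x)"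
  using assms
proof induction
  case (wave d v)
  have "(\<lambda>x. c * iexp (u \<bullet> x) * (d * iexp (v \<bullet> x))) = (\<lambda>x. (c * d) * iexp ((u + v) \<bullet> x))"
    by (simp add: fun_eq_iff inner_add_left exp_add distrib_left algebra_simps)
  then show ?case
    using trig_polynomial.wave by metis
next
  case (add f g)
  then show ?case
    using trig_polynomial.add by (force simp: distrib_left)
qed

lemma trig_polynomial_mult:
  assumes "trig_polynomial f" "trig_polynomial g"
  shows "trig_polynomial (\<lambda>x. f x * g x)"
  using assms(1)
proof induction
  case (wave c u)
  show ?case by (rule trig_polynomial_wave_mult[OF assms(2)])
next
  case (add f1 f2)
  then show ?case
    using trig_polynomial.add by (force simp: distrib_right)
qed

lemma trig_polynomial_sum:
  assumes "finite I" "\<And>i. i \<in> I \<Longrightarrow> trig_polynomial (f i)"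
  shows "trig_polynomial (\<lambda>x. \<Sum>i\<in>I. f i x)"
  using assms by (induction) (auto intro: trig_polynomial_const trig_polynomial.add)

lemma trig_polynomial_sin: "trig_polynomial (\<lambda>x. complex_of_real (c * sin (k * (x \<bullet> b))))"
proof -
  have eq: "complex_of_real (c * sin (k * (x \<bullet> b))) =
      (of_real c / (2 * \<i>)) * iexp ((k *\<^sub>R b) \<bullet> x) + (- of_real c / (2 * \<i>)) * iexp ((- k *\<^sub>R b) \<bullet> x)" for x
    by (simp add: sin_exp_eq sin_of_real [symmetric] inner_commute field_simps)
  show ?thesis
    unfolding eq by (intro trig_polynomial.intros)
qed

text \<open>
  Polynomials in the sines of the coordinates are trigonometric polynomials, and on a box on which
  the sine is invertible they are uniformly dense in the continuous functions. They are bounded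
  globally by their maximum over one cube, which keeps the approximation under control far away.
\<close>

definition coordinate_sin :: "real \<Rightarrow> 'a::euclidean_space \<Rightarrow> 'a" where
  "coordinate_sin k x = (\<Sum>b\<in>Basis. sin (k * (x \<bullet> b)) *\<^sub>R b)"

lemma trig_polynomial_compose_coordinate_sin:
  fixes p :: "'a::euclidean_space \<Rightarrow> real"
  assumes "real_polynomial_function p"
  shows "trig_polynomial (\<lambda>x. complex_of_real (p (coordinate_sin k x)))"
  using assms
proof induction
  case (linear f)
  then interpret bounded_linear f .
  have "f (coordinate_sin k x) = (\<Sum>b\<in>Basis. f b * sin (k * (x \<bullet> b)))" for x
    by (simp add: coordinate_sin_def sum scaleR mult.commute)
  then show ?case
    using trig_polynomial_sum[OF finite_Basis trig_polynomial_sin, of f "\<lambda>_. k" "\<lambda>b. b"] by simp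
next
  case (const c)
  show ?case by (rule trig_polynomial_const)
next
  case (add f g)
  then show ?case using trig_polynomial.add by force
next
  case (mult f g)
  then show ?case using trig_polynomial_mult by force
qed

lemma trig_polynomial_bounded_continuous:
  assumes "trig_polynomial f"
  shows "(\<exists>B. \<forall>x. norm (f x) \<le> B) \<and> continuous_on UNIV f"
  using assms
proof induction
  case (wave c u)
  have "norm (c * iexp (u \<bullet> x)) \<le> norm c" for x
    by (simp add: norm_mult)
  moreover have "continuous_on UNIV (\<lambda>x. c * iexp (u \<bullet> x))"
    by (intro continuous_intros)
  ultimately show ?case by blast
next
  case (add f g)
  then obtain B C where "\<And>x. norm (f x) \<le> B" "\<And>x. norm (g x) \<le> C" by blast
  then have "norm (f x + g x) \<le> B + C" for x
    by (meson add_mono norm_triangle_ineq order_trans)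
  with add show ?case by (auto intro: continuous_on_add)
qed

lemma integrable_bounded_continuous:
  fixes f :: "'b::topological_space \<Rightarrow> 'c::{banach, second_countable_topology}"
  assumes "prob_space M" and M: "sets M = sets borel"
    and cont: "continuous_on UNIV f" and B: "\<And>x. norm (f x) \<le> B"
  shows "integrable M f"
proof -
  interpret prob_space M by fact
  show ?thesis
  proof (rule integrable_const_bound)
    show "AE x in M. norm (f x) \<le> B" using B by simp
    show "f \<in> borel_measurable M"
      using borel_measurable_continuous_onI[OF cont] measurable_cong_sets[OF M refl] by blast
  qed
qed

lemma trig_polynomial_integral_convergence:
  fixes \<mu> :: "nat \<Rightarrow> 'a::euclidean_space measure"
  assumes prob: "\<And>n. prob_space (\<mu> n)" "prob_space \<nu>"
    and sets: "\<And>n. sets (\<mu> n) = sets borel" "sets \<nu> = sets borel"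
    and char: "\<And>u. (\<lambda>n. \<integral>x. iexp (u \<bullet> x) \<partial>\<mu> n) \<longlonglongrightarrow> (\<integral>x. iexp (u \<bullet> x) \<partial>\<nu>)"
    and "trig_polynomial g"
  shows "(\<lambda>n. \<integral>x. g x \<partial>\<mu> n) \<longlonglongrightarrow> (\<integral>x. g x \<partial>\<nu>)"
  using assms(6)
proof induction
  case (wave c u)
  show ?case by (simp add: tendsto_mult_left[OF char])
next
  case (add f g)
  obtain B where B: "\<And>x. norm (f x) \<le> B" using trig_polynomial_bounded_continuous[OF add(1)] by blast
  obtain C where C: "\<And>x. norm (g x) \<le> C" using trig_polynomial_bounded_continuous[OF add(2)] by blast
  have c: "continuous_on UNIV f" "continuous_on UNIV g"
    using trig_polynomial_bounded_continuous add(1,2) by blast+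
  note i = integrable_bounded_continuous
  have "integrable (\<mu> n) f" "integrable (\<mu> n) g" "integrable \<nu> f" "integrable \<nu> g" for n
    using i[OF prob(1) sets(1) c(1) B] i[OF prob(1) sets(1) c(2) C]
      i[OF prob(2) sets(2) c(1) B] i[OF prob(2) sets(2) c(2) C] by auto
  then show ?case using tendsto_add[OF add(3,4)] by simp
qed

text \<open>
  A continuous stand-in for the indicator of \<open>\<bar>s\<bar> > R\<close>, so that weak convergence applies to it.
\<close>

definition tail_weight :: "real \<Rightarrow> real \<Rightarrow> real" where
  "tail_weight R s = min 1 (max 0 (\<bar>s\<bar> - R))"

lemma tail_weight_bounds: "0 \<le> tail_weight R s" "tail_weight R s \<le> 1" "\<bar>tail_weight R s\<bar> \<le> 1"
  by (auto simp: tail_weight_def)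

lemma continuous_tail_weight: "continuous_on A (tail_weight R)"
  unfolding tail_weight_def by (intro continuous_intros)

text \<open>
  The characteristic function of a coordinate is the restriction of the joint one to a line, so the
  one-dimensional continuity theorem gives uniform control of the tails.
\<close>

lemma marginal_tail_convergence:
  fixes \<mu> :: "nat \<Rightarrow> 'a::euclidean_space measure"
  assumes prob: "\<And>n. prob_space (\<mu> n)" "prob_space \<nu>"
    and sets: "\<And>n. sets (\<mu> n) = sets borel" "sets \<nu> = sets borel"
    and char: "\<And>u. (\<lambda>n. \<integral>x. iexp (u \<bullet> x) \<partial>\<mu> n) \<longlonglongrightarrow> (\<integral>x. iexp (u \<bullet> x) \<partial>\<nu>)"
  shows "(\<lambda>n. \<integral>x. tail_weight R (x \<bullet> b) \<partial>\<mu> n) \<longlonglongrightarrow> (\<integral>x. tail_weight R (x \<bullet> b) \<partial>\<nu>)"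
proof -
  have m: "(\<lambda>x. x \<bullet> b) \<in> borel_measurable (\<mu> n)" "(\<lambda>x. x \<bullet> b) \<in> borel_measurable \<nu>" for n
    using sets by (auto cong: measurable_cong_sets)
  define P where "P n = distr (\<mu> n) borel (\<lambda>x. x \<bullet> b)" for n
  define Q where "Q = distr \<nu> borel (\<lambda>x. x \<bullet> b)"
  have P: "real_distribution (P n)" for n
    unfolding P_def by (rule prob_space.real_distribution_distr[OF prob(1) m(1)])
  have Q: "real_distribution Q"
    unfolding Q_def by (rule prob_space.real_distribution_distr[OF prob(2) m(2)])
  have "char (P n) s = (\<integral>x. iexp ((s *\<^sub>R b) \<bullet> x) \<partial>\<mu> n)" for n s
    unfolding char_def P_def by (subst integral_distr[OF m(1)]) (auto simp: inner_commute)
  moreover have "char Q s = (\<integral>x. iexp ((s *\<^sub>R b) \<bullet> x) \<partial>\<nu>)" for s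
    unfolding char_def Q_def by (subst integral_distr[OF m(2)]) (auto simp: inner_commute)
  ultimately have "weak_conv_m P Q"
    using char by (intro levy_continuity P Q) (simp only:)
  then have "(\<lambda>n. integral\<^sup>L (P n) (tail_weight R)) \<longlonglongrightarrow> integral\<^sup>L Q (tail_weight R)"
    using continuous_tail_weight[of UNIV R] tail_weight_bounds(3)
    by (intro weak_conv_imp_integral_bdd_continuous_conv[where B=1] P Q)
       (auto simp: continuous_on_eq_continuous_at)
  moreover have "tail_weight R \<in> borel_measurable borel"
    by (intro borel_measurable_continuous_onI continuous_tail_weight)
  ultimately show ?thesis
    unfolding P_def Q_def by (simp add: integral_distr[OF m(1)] integral_distr[OF m(2)])
qed

text \<open>
  Put \<open>k = \<pi> / (2 R)\<close>. On the box, \<open>x\<close> is recovered from the sines of \<open>k x\<close> by the arcsine, so \<open>f\<close>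
  becomes a continuous function of these sines. Its extension to all of \<open>[-1,1]\<^sup>n\<close> takes only values
  of \<open>f\<close>, and is approximated by a polynomial on that cube.
\<close>

lemma trig_polynomial_approximation:
  fixes f :: "'a::euclidean_space \<Rightarrow> real"
  assumes cont: "continuous_on UNIV f" and B: "\<And>x. \<bar>f x\<bar> \<le> B" and "0 < \<epsilon>" "0 < R"
  obtains g :: "'a \<Rightarrow> real" where "trig_polynomial (\<lambda>x. complex_of_real (g x))"
    and "\<And>x. \<bar>g x\<bar> \<le> B + \<epsilon>"
    and "\<And>x. (\<And>b. b \<in> Basis \<Longrightarrow> \<bar>x \<bullet> b\<bar> \<le> R) \<Longrightarrow> \<bar>f x - g x\<bar> \<le> \<epsilon>"
proof -
  define k where "k = pi / (2 * R)"
  have "k > 0" using \<open>0 < R\<close> by (simp add: k_def)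
  define F where "F y = f (\<Sum>b\<in>Basis. (arcsin (y \<bullet> b) / k) *\<^sub>R b)" for y
  define S where "S = cbox (- One) (One :: 'a)"
  have S: "y \<in> S \<longleftrightarrow> (\<forall>b\<in>Basis. -1 \<le> y \<bullet> b \<and> y \<bullet> b \<le> 1)" for y
    by (auto simp: S_def mem_box)
  have "continuous_on S F"
    unfolding F_def
    using \<open>k > 0\<close> by (intro continuous_on_compose2[OF cont] continuous_intros) (auto simp: S)
  then obtain p where p: "real_polynomial_function p" "\<And>y. y \<in> S \<Longrightarrow> \<bar>F y - p y\<bar> < \<epsilon>"
    using Stone_Weierstrass_real_polynomial_function[of S F \<epsilon>] \<open>0 < \<epsilon>\<close> by (auto simp: S_def)
  have coord: "coordinate_sin k x \<bullet> b = sin (k * (x \<bullet> b))" if "b \<in> Basis" for x b :: 'a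
    using that by (simp add: coordinate_sin_def inner_sum_left_Basis)
  have inS: "coordinate_sin k x \<in> S" for x :: 'a
    by (simp add: S coord)
  show thesis
  proof
    show "trig_polynomial (\<lambda>x. complex_of_real (p (coordinate_sin k x)))"
      by (rule trig_polynomial_compose_coordinate_sin[OF p(1)])
    show "\<bar>p (coordinate_sin k x)\<bar> \<le> B + \<epsilon>" for x
    proof -
      have "\<bar>F (coordinate_sin k x)\<bar> \<le> B" using B by (simp add: F_def)
      with p(2)[OF inS[of x]] show ?thesis by linarith
    qed
    show "\<bar>f x - p (coordinate_sin k x)\<bar> \<le> \<epsilon>" if x: "\<And>b. b \<in> Basis \<Longrightarrow> \<bar>x \<bullet> b\<bar> \<le> R" for x
    proof -
      have "arcsin (coordinate_sin k x \<bullet> b) / k = x \<bullet> b" if b: "b \<in> Basis" for b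
      proof -
        have "\<bar>k * (x \<bullet> b)\<bar> \<le> k * R"
          using x[OF b] \<open>k > 0\<close> by (simp add: abs_mult)
        also have "k * R = pi / 2" using \<open>0 < R\<close> by (simp add: k_def)
        finally show ?thesis using \<open>k > 0\<close> by (simp add: coord[OF b] arcsin_sin abs_le_iff)
      qed
      then have "F (coordinate_sin k x) = f x"
        by (simp add: F_def euclidean_representation)
      with p(2)[OF inS[of x]] show ?thesis by simp
    qed
  qed
qed

lemma tail_weight_integral_tendsto_0:
  assumes "prob_space \<nu>" and m: "f \<in> borel_measurable \<nu>"
  shows "(\<lambda>n. \<integral>x. tail_weight (real n) (f x) \<partial>\<nu>) \<longlonglongrightarrow> 0"
proof -
  interpret prob_space \<nu> by fact
  have "(\<lambda>n. \<integral>x. tail_weight (real n) (f x) \<partial>\<nu>) \<longlonglongrightarrow> (\<integral>x. 0 \<partial>\<nu>)"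
  proof (rule integral_dominated_convergence[where w="\<lambda>_. 1"])
    show "(\<lambda>x. tail_weight (real n) (f x)) \<in> borel_measurable \<nu>" for n
      unfolding tail_weight_def using m by measurable
    show "AE x in \<nu>. (\<lambda>n. tail_weight (real n) (f x)) \<longlonglongrightarrow> 0"
    proof (rule AE_I2)
      fix x
      have "\<forall>\<^sub>F n in sequentially. tail_weight (real n) (f x) = 0"
        using eventually_ge_at_top[of "nat \<lceil>\<bar>f x\<bar>\<rceil>"]
        by eventually_elim (auto simp: tail_weight_def max_def min_def nat_le_iff ceiling_le_iff)
      then show "(\<lambda>n. tail_weight (real n) (f x)) \<longlonglongrightarrow> 0" by (rule tendsto_eventually)
    qed
    show "AE x in \<nu>. norm (tail_weight (real n) (f x)) \<le> 1" for n
      using tail_weight_bounds(3) by simp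
  qed auto
  then show ?thesis by simp
qed

text \<open>
  A bounded continuous \<open>f\<close> is within \<open>\<epsilon>\<close> of a trigonometric polynomial on a large box, and off the
  box the difference is at most a constant times the sum of the tail weights of the coordinates.
  Both integrals converge, the second one to a limit that is small for a large box.
\<close>

theorem levy_continuity_euclidean:
  fixes \<mu> :: "nat \<Rightarrow> 'a::euclidean_space measure"
  assumes prob: "\<And>n. prob_space (\<mu> n)" "prob_space \<nu>"
    and sets: "\<And>n. sets (\<mu> n) = sets borel" "sets \<nu> = sets borel"
    and char: "\<And>u. (\<lambda>n. \<integral>x. iexp (u \<bullet> x) \<partial>\<mu> n) \<longlonglongrightarrow> (\<integral>x. iexp (u \<bullet> x) \<partial>\<nu>)"
  shows "weakly_converges \<mu> \<nu>"
  unfolding weakly_converges_def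
proof (intro allI impI)
  fix f :: "'a \<Rightarrow> real"
  assume cont: "continuous_on UNIV f" and "bounded (range f)"
  then obtain B where "B > 0" and B: "\<And>x. \<bar>f x\<bar> \<le> B"
    unfolding bounded_pos by auto
  define T where "T R x = (\<Sum>b\<in>Basis. tail_weight R (x \<bullet> b))" for R and x :: 'a
  have Tint: "integrable M (\<lambda>x. tail_weight R (x \<bullet> b))"
    if "prob_space M" "sets M = sets borel" for M :: "'a measure" and R and b :: 'a
    using that tail_weight_bounds
    by (intro integrable_bounded_continuous[where B=1]
          continuous_on_compose2[OF continuous_tail_weight, of UNIV] continuous_intros) auto
  have Tint': "integrable M (T R)" if "prob_space M" "sets M = sets borel" for M R
    unfolding T_def using Tint[OF that] by auto
  have T_conv: "(\<lambda>n. \<integral>x. T R x \<partial>\<mu> n) \<longlonglongrightarrow> (\<integral>x. T R x \<partial>\<nu>)" for R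
    unfolding T_def using Tint[OF prob(1) sets(1)] Tint[OF prob(2) sets(2)]
    by (simp add: tendsto_sum marginal_tail_convergence[OF prob sets char])
  have T_0: "(\<lambda>n. \<integral>x. T (real n) x \<partial>\<nu>) \<longlonglongrightarrow> 0"
  proof -
    have "(\<lambda>x. x \<bullet> b) \<in> borel_measurable \<nu>" for b
      using sets(2) by (auto cong: measurable_cong_sets)
    then have "(\<lambda>n. \<Sum>b\<in>(Basis::'a set). \<integral>x. tail_weight (real n) (x \<bullet> b) \<partial>\<nu>) \<longlonglongrightarrow> (\<Sum>b\<in>(Basis::'a set). 0)"
      by (intro tendsto_sum tail_weight_integral_tendsto_0 prob)
    then show ?thesis
      unfolding T_def using Tint[OF prob(2) sets(2)] by simp
  qed
  show "(\<lambda>n. \<integral>x. f x \<partial>\<mu> n) \<longlonglongrightarrow> (\<integral>x. f x \<partial>\<nu>)"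
  proof (rule LIMSEQ_I)
    fix r :: real assume "0 < r"
    define \<epsilon> where "\<epsilon> = min (r / 8) B"
    have \<epsilon>: "0 < \<epsilon>" "\<epsilon> \<le> r / 8" "\<epsilon> \<le> B" using \<open>0 < r\<close> \<open>B > 0\<close> by (auto simp: \<epsilon>_def)
    \<comment> \<open>With this choice the tails contribute at most \<open>3 B (2 \<delta> + \<delta>) = 9 r / 32\<close> in the end.\<close>
    define \<delta> where "\<delta> = r / (32 * B)"
    have "\<delta> > 0" using \<open>0 < r\<close> \<open>B > 0\<close> by (simp add: \<delta>_def)
    have "\<forall>\<^sub>F n in sequentially. (\<integral>x. T (real n) x \<partial>\<nu>) < \<delta>"
      using T_0 \<open>\<delta> > 0\<close> by (rule order_tendstoD(2))
    then obtain m where m: "(\<integral>x. T (real m) x \<partial>\<nu>) < \<delta>"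
      by (auto simp: eventually_sequentially)
    define R where "R = real m"
    obtain g :: "'a \<Rightarrow> real" where g: "trig_polynomial (\<lambda>x. complex_of_real (g x))"
      "\<And>x. \<bar>g x\<bar> \<le> B + \<epsilon>"
      "\<And>x. (\<And>b. b \<in> Basis \<Longrightarrow> \<bar>x \<bullet> b\<bar> \<le> R + 1) \<Longrightarrow> \<bar>f x - g x\<bar> \<le> \<epsilon>"
      using trig_polynomial_approximation[OF cont B \<epsilon>(1), of "R + 1"] by (auto simp: R_def)
    \<comment> \<open>Outside the box some tail weight equals 1, and there the difference is at most \<open>2 B + \<epsilon> \<le> 3 B\<close>.\<close>
    have approx: "\<bar>f x - g x\<bar> \<le> \<epsilon> + 3 * B * T R x" for x
    proof (cases "\<forall>b\<in>Basis. \<bar>x \<bullet> b\<bar> \<le> R + 1")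
      case True
      then have "\<bar>f x - g x\<bar> \<le> \<epsilon>" using g(3) by blast
      moreover have "0 \<le> T R x" unfolding T_def by (intro sum_nonneg tail_weight_bounds)
      ultimately show ?thesis using \<open>B > 0\<close> by (simp add: add_increasing2)
    next
      case False
      then obtain b where b: "b \<in> Basis" "\<bar>x \<bullet> b\<bar> > R + 1" by force
      have "1 = tail_weight R (x \<bullet> b)" using b by (simp add: tail_weight_def)
      also have "\<dots> \<le> T R x"
        unfolding T_def by (rule member_le_sum) (auto simp: b tail_weight_bounds)
      finally have "3 * B * 1 \<le> 3 * B * T R x" using \<open>B > 0\<close> by (intro mult_left_mono) auto
      with B[of x] g(2)[of x] \<epsilon> show ?thesis by linarith
    qed
    have gc: "continuous_on UNIV g"
    proof -
      have "continuous_on UNIV (\<lambda>x. Re (complex_of_real (g x)))"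
        using trig_polynomial_bounded_continuous[OF g(1)] by (intro continuous_intros) auto
      then show ?thesis by simp
    qed
    have dist: "\<bar>(\<integral>x. f x \<partial>M) - (\<integral>x. g x \<partial>M)\<bar> \<le> \<epsilon> + 3 * B * (\<integral>x. T R x \<partial>M)"
      if M: "prob_space M" "sets M = sets borel" for M
    proof -
      interpret prob_space M by fact
      have i: "integrable M f" "integrable M g"
        using B g(2) by (auto intro!: integrable_bounded_continuous[OF M cont] integrable_bounded_continuous[OF M gc])
      then have "\<bar>(\<integral>x. f x \<partial>M) - (\<integral>x. g x \<partial>M)\<bar> = \<bar>\<integral>x. f x - g x \<partial>M\<bar>" by simp
      also have "\<dots> \<le> (\<integral>x. \<bar>f x - g x\<bar> \<partial>M)" by (rule integral_abs_bound)
      also have "\<dots> \<le> (\<integral>x. \<epsilon> + 3 * B * T R x \<partial>M)"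
        using i Tint'[OF M, of R] approx by (intro integral_mono) auto
      also have "\<dots> = \<epsilon> + 3 * B * (\<integral>x. T R x \<partial>M)"
        using Tint'[OF M, of R] by (simp add: prob_space)
      finally show ?thesis .
    qed
    have "(\<lambda>n. \<integral>x. g x \<partial>\<mu> n) \<longlonglongrightarrow> (\<integral>x. g x \<partial>\<nu>)"
      using trig_polynomial_integral_convergence[OF prob sets char g(1)]
      by (simp add: integral_complex_of_real tendsto_of_real_iff)
    then have "\<forall>\<^sub>F n in sequentially. \<bar>(\<integral>x. g x \<partial>\<mu> n) - (\<integral>x. g x \<partial>\<nu>)\<bar> < r / 8"
      using \<open>0 < r\<close> unfolding tendsto_iff dist_real_def by (metis divide_pos_pos zero_less_numeral)
    moreover have "\<forall>\<^sub>F n in sequentially. (\<integral>x. T R x \<partial>\<mu> n) < 2 * \<delta>"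
      using m \<open>\<delta> > 0\<close> T_conv[of R] by (intro order_tendstoD(2)) (auto simp: R_def)
    ultimately have "\<forall>\<^sub>F n in sequentially. norm ((\<integral>x. f x \<partial>\<mu> n) - (\<integral>x. f x \<partial>\<nu>)) < r"
    proof eventually_elim
      case (elim n)
      have "B * (\<integral>x. T R x \<partial>\<mu> n) \<le> B * (2 * \<delta>)" "B * (\<integral>x. T R x \<partial>\<nu>) \<le> B * \<delta>"
        using elim m \<open>B > 0\<close> by (auto simp: R_def)
      moreover have "B * \<delta> = r / 32" using \<open>B > 0\<close> by (simp add: \<delta>_def)
      ultimately show ?case
        using dist[OF prob(1) sets(1), of n] dist[OF prob(2) sets(2)] elim(1) \<epsilon>(2) \<open>0 < r\<close>
        unfolding real_norm_def by linarith
    qed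
    then show "\<exists>no. \<forall>n\<ge>no. norm ((\<integral>x. f x \<partial>\<mu> n) - (\<integral>x. f x \<partial>\<nu>)) < r"
      by (simp add: eventually_sequentially)
  qed
qed

section \<open>The Gaussian limit law\<close>

lemma Basis_vec2: "(Basis :: (real ^ 2) set) = {axis 1 1, axis 2 1}"
  by (auto simp: Basis_vec_def UNIV_2)

lemma measurable_vector2 [measurable]:
  fixes f g :: "'a \<Rightarrow> real"
  assumes [measurable]: "f \<in> borel_measurable M" "g \<in> borel_measurable M"
  shows "(\<lambda>x. vector [f x, g x] :: real ^ 2) \<in> borel_measurable M"
proof (subst borel_measurable_euclidean_space, intro ballI)
  fix b :: "real ^ 2" assume "b \<in> Basis"
  then show "(\<lambda>x. vector [f x, g x] \<bullet> b) \<in> borel_measurable M"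
    by (auto simp: Basis_vec2 inner_axis)
qed

lemma inner_vector2: "u \<bullet> (vector [a, b] :: real ^ 2) = u $ 1 * a + u $ 2 * b"
  by (simp add: inner_vec_def sum_2)

text \<open>
  The space \<open>real ^ 2\<close> is not literally a product; this transports Fubini's theorem to it.
\<close>

lemma lborel_vec2: "(lborel :: (real ^ 2) measure) = distr (lborel \<Otimes>\<^sub>M lborel) borel (\<lambda>p. vector [fst p, snd p])"
proof (rule lborel_eqI)
  fix l u :: "real ^ 2"
  assume le: "\<And>b. b \<in> Basis \<Longrightarrow> l \<bullet> b \<le> u \<bullet> b"
  from this[of "axis 1 1"] this[of "axis 2 1"] have le: "l $ 1 \<le> u $ 1" "l $ 2 \<le> u $ 2"
    by (simp_all add: Basis_vec2 inner_axis)
  have "(\<lambda>p. vector [fst p, snd p] :: real ^ 2) -` box l u \<inter> space (lborel \<Otimes>\<^sub>M lborel)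
      = {l $ 1 <..< u $ 1} \<times> {l $ 2 <..< u $ 2}"
    by (auto simp: mem_box_cart forall_2 space_pair_measure)
  then have "emeasure (distr (lborel \<Otimes>\<^sub>M lborel) borel (\<lambda>p. vector [fst p, snd p] :: real ^ 2)) (box l u)
      = ennreal (u $ 1 - l $ 1) * ennreal (u $ 2 - l $ 2)"
    by (subst emeasure_distr) (simp_all add: lborel.emeasure_pair_measure_Times le)
  also have "\<dots> = ennreal (\<Prod>b\<in>Basis. (u - l) \<bullet> b)"
    using le by (simp add: Basis_vec2 inner_axis axis_eq_axis ennreal_mult)
  finally show "emeasure (distr (lborel \<Otimes>\<^sub>M lborel) borel (\<lambda>p. vector [fst p, snd p] :: real ^ 2)) (box l u)
      = ennreal (\<Prod>b\<in>Basis. (u - l) \<bullet> b)" .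
qed simp

definition half_normal :: "real measure" where
  "half_normal = density lborel (\<lambda>x. ennreal (normal_density 0 (sqrt (1/2)) x))"

lemma prob_space_half_normal: "prob_space half_normal"
  unfolding half_normal_def by (rule prob_space_normal_density) simp

lemma sets_half_normal [simp, measurable_cong]: "sets half_normal = sets borel"
  by (simp add: half_normal_def)

lemma char_half_normal: "char half_normal u = complex_of_real (exp (- (u^2) / 4))"
proof -
  interpret std: prob_space std_normal_distribution by (rule prob_space_normal_density) simp
  have "distributed std_normal_distribution lborel (\<lambda>x. x) std_normal_density"
    by (auto simp: distributed_def distr_id2 intro!: distr_id2)
  from std.normal_density_affine[OF this, of "sqrt (1/2)" 0]
  have "distributed std_normal_distribution lborel (\<lambda>x. sqrt (1/2) * x) (normal_density 0 (sqrt (1/2)))"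
    by simp
  then have "half_normal = distr std_normal_distribution lborel (\<lambda>x. sqrt (1/2) * x)"
    by (simp add: half_normal_def distributed_distr_eq_density)
  then have "char half_normal u = char (distr std_normal_distribution lborel (\<lambda>x. sqrt (1/2) * x)) u"
    by simp
  also have "\<dots> = char std_normal_distribution (sqrt (1/2) * u)"
    unfolding char_def by (subst integral_distr) (simp_all add: ac_simps)
  also have "\<dots> = complex_of_real (exp (- (u^2) / 4))"
    by (simp add: char_std_normal_distribution power_mult_distrib)
  finally show ?thesis .
qed

lemma matrix_inv_half: "matrix_inv (vector [vector [1/2, 0], vector [0, 1/2]] :: real ^ 2 ^ 2) = mat 2"
proof -
  have "(vector [vector [1/2, 0], vector [0, 1/2]] :: real ^ 2 ^ 2) = mat (1/2)"
    by (simp add: vec_eq_iff forall_2 mat_def)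
  moreover have "matrix_inv (mat (1/2) :: real ^ 2 ^ 2) = mat 2"
  proof -
    have inv: "(mat 2 :: real ^ 2 ^ 2) ** mat (1/2) = mat 1" "(mat (1/2) :: real ^ 2 ^ 2) ** mat 2 = mat 1"
      by (simp_all add: matrix_matrix_mult_def mat_def vec_eq_iff forall_2 sum_2)
    then have "(mat (1/2) :: real ^ 2 ^ 2) ** matrix_inv (mat (1/2)) = mat 1"
      unfolding matrix_inv_def by (metis (mono_tags, lifting) someI_ex)
    then have "(mat 2 ** mat (1/2)) ** matrix_inv (mat (1/2)) = (mat 2 :: real ^ 2 ^ 2)"
      by (simp only: matrix_mul_assoc [symmetric] matrix_mul_rid)
    with inv show ?thesis by simp
  qed
  ultimately show ?thesis by simp
qed

lemma centered_gaussian_half: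
  "centered_gaussian (vector [vector [1/2, 0], vector [0, 1/2]] :: real ^ 2 ^ 2) =
     distr (half_normal \<Otimes>\<^sub>M half_normal) borel (\<lambda>p. vector [fst p, snd p])"
  (is "?G = _")
proof -
  let ?n = "normal_density 0 (sqrt (1/2))"
  let ?T = "\<lambda>p. vector [fst p, snd p] :: real ^ 2"
  have dens: "exp (- (?T p \<bullet> (2 *\<^sub>R ?T p)) / 2) / sqrt ((2 * pi) ^ CARD(2) * (1/4)) = ?n (fst p) * ?n (snd p)"
    for p :: "real \<times> real"
  proof -
    have "?T p \<bullet> (2 *\<^sub>R ?T p) / 2 = (fst p)\<^sup>2 + (snd p)\<^sup>2"
      by (simp add: inner_vector2 power2_eq_square)
    moreover have "sqrt ((2 * pi) ^ CARD(2) * (1/4)) = pi"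
      by (simp add: real_sqrt_mult real_sqrt_divide real_sqrt_power)
    ultimately show ?thesis
      by (simp add: normal_density_def exp_add [symmetric] exp_minus_inverse mult_exp_exp field_simps)
  qed
  have mat2: "mat 2 *v x = 2 *\<^sub>R x" for x :: "real ^ 2"
    by (simp add: vec_eq_iff matrix_vector_mult_def mat_def if_distrib [of "\<lambda>a. a * _"] cong: if_cong)
  have det: "det (vector [vector [1/2, 0], vector [0, 1/2]] :: real ^ 2 ^ 2) = 1/4"
    by (simp add: det_2)
  have "?G = density (distr (lborel \<Otimes>\<^sub>M lborel) borel ?T)
      (\<lambda>x. ennreal (exp (- (x \<bullet> (2 *\<^sub>R x)) / 2) / sqrt ((2 * pi) ^ CARD(2) * (1/4))))"
    unfolding centered_gaussian_def matrix_inv_half det mat2 lborel_vec2 [symmetric] ..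
  also have "\<dots> = distr (density (lborel \<Otimes>\<^sub>M lborel) (\<lambda>p. ennreal (?n (fst p) * ?n (snd p)))) borel ?T"
    by (subst density_distr) (simp_all only: dens, measurable)
  also have "density (lborel \<Otimes>\<^sub>M lborel) (\<lambda>p. ennreal (?n (fst p) * ?n (snd p))) = half_normal \<Otimes>\<^sub>M half_normal"
    unfolding half_normal_def
    by (subst pair_measure_density)
       (auto simp: ennreal_mult split_beta' half_normal_def[symmetric]
          intro!: lborel.sigma_finite_measure_axioms prob_space_imp_sigma_finite prob_space_half_normal)
  finally show ?thesis .
qed

lemma prob_space_half_normal_pair: "prob_space (half_normal \<Otimes>\<^sub>M half_normal)"
proof -
  interpret prob_space half_normal by (rule prob_space_half_normal)
  interpret pair_prob_space half_normal half_normal ..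
  show ?thesis by (rule prob_space_axioms)
qed

lemma prob_space_centered_gaussian_half:
  "prob_space (centered_gaussian (vector [vector [1/2, 0], vector [0, 1/2]] :: real ^ 2 ^ 2))"
  unfolding centered_gaussian_half by (intro prob_space.prob_space_distr prob_space_half_normal_pair) measurable

lemma char_centered_gaussian_half:
  "(\<integral>x. iexp (u \<bullet> x) \<partial>centered_gaussian (vector [vector [1/2, 0], vector [0, 1/2]] :: real ^ 2 ^ 2))
    = complex_of_real (exp (- ((u $ 1)\<^sup>2 + (u $ 2)\<^sup>2) / 4))"
proof -
  interpret prob_space half_normal by (rule prob_space_half_normal)
  interpret pair: pair_prob_space half_normal half_normal ..
  have "(\<integral>x. iexp (u \<bullet> x) \<partial>centered_gaussian (vector [vector [1/2, 0], vector [0, 1/2]] :: real ^ 2 ^ 2))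
      = (\<integral>p. iexp (u $ 1 * fst p) * iexp (u $ 2 * snd p) \<partial>(half_normal \<Otimes>\<^sub>M half_normal))"
    unfolding centered_gaussian_half
    by (subst integral_distr) (simp_all add: inner_vector2 exp_add distrib_left)
  also have "\<dots> = (\<integral>a. \<integral>b. iexp (u $ 1 * a) * iexp (u $ 2 * b) \<partial>half_normal \<partial>half_normal)"
    by (subst pair.integral_fst' [symmetric])
       (auto intro!: pair.integrable_const_bound[where B=1] simp: norm_mult)
  also have "\<dots> = char half_normal (u $ 1) * char half_normal (u $ 2)"
    by (simp add: char_def)
  also have "\<dots> = complex_of_real (exp (- ((u $ 1)\<^sup>2 + (u $ 2)\<^sup>2) / 4))"
    by (simp add: char_half_normal exp_add [symmetric] add_divide_distrib flip: of_real_mult)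
  finally show ?thesis .
qed

section \<open>Integrals of floor functions over the circle\<close>

lemma space_circle_measure [simp]: "space circle_measure = {0..<1}"
  by (simp add: circle_measure_def space_restrict_space)

lemma measurable_circle_measureI: "f \<in> borel_measurable borel \<Longrightarrow> f \<in> borel_measurable circle_measure"
  unfolding circle_measure_def by (rule measurable_restrict_space1) simp

lemma prob_space_circle_measure: "prob_space circle_measure"
  by (rule prob_spaceI) (simp add: circle_measure_def emeasure_restrict_space space_restrict_space)

interpretation circle: prob_space circle_measure
  by (rule prob_space_circle_measure)

lemma integral_circle_measure:
  fixes f :: "real \<Rightarrow> 'a::{banach, second_countable_topology}"
  shows "(\<integral>x. f x \<partial>circle_measure) = (\<integral>x. indicator {0..<1} x *\<^sub>R f x \<partial>lborel)"
  by (simp add: circle_measure_def integral_restrict_space)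

lemma integrable_circle_bounded:
  fixes f :: "real \<Rightarrow> 'a::{banach, second_countable_topology}"
  assumes "f \<in> borel_measurable borel" "\<And>x. x \<in> {0..<1} \<Longrightarrow> norm (f x) \<le> B"
  shows "integrable circle_measure f"
  using assms by (intro circle.integrable_const_bound[where B=B] AE_I2 measurable_circle_measureI) auto

lemma periodic_int:
  fixes f :: "real \<Rightarrow> 'a"
  assumes "\<And>x. f (x + 1) = f x"
  shows "f (x + of_int n) = f x"
proof (induction n arbitrary: x rule: int_induct[where k=0])
  case (step1 i)
  then show ?case using assms[of "x + of_int i"] by (simp add: ac_simps)
next
  case (step2 i)
  then show ?case using assms[of "x + of_int (i - 1)"] by (simp add: ac_simps)
qed simp

text \<open>
  Only the fractional part \<open>r\<close> of \<open>s\<close> matters. The integral over \<open>[r, 1 + r)\<close> differs from the one over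
  \<open>[0, 1)\<close> by moving the piece over \<open>[1, 1 + r)\<close> back by one period.
\<close>

lemma integral_circle_shift:
  fixes f :: "real \<Rightarrow> 'a::{banach, second_countable_topology}"
  assumes [measurable]: "f \<in> borel_measurable borel"
    and bound: "\<And>x. norm (f x) \<le> B"
    and periodic: "\<And>x. f (x + 1) = f x"
  shows "(\<integral>x. f (x + s) \<partial>circle_measure) = (\<integral>x. f x \<partial>circle_measure)"
proof -
  define r where "r = frac s"
  have r: "0 \<le> r" "r < 1" by (auto simp: r_def frac_lt_1)
  have int: "integrable lborel (\<lambda>x. indicator {a..<b} x *\<^sub>R f x)" for a b :: real
  proof (rule integrableI_bounded_set_indicator[where B=B])
    show "emeasure lborel {a..<b} < \<infinity>" by (cases "a \<le> b") auto
  qed (use bound in auto)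
  have "f (x + s) = f (x + r)" for x
    using periodic_int[of f "x + r" "\<lfloor>s\<rfloor>", OF periodic] by (simp add: r_def frac_def)
  then have "(\<integral>x. f (x + s) \<partial>circle_measure) = (\<integral>x. indicator {0..<1} x *\<^sub>R f (x + r) \<partial>lborel)"
    by (simp add: integral_circle_measure)
  also have "\<dots> = (\<integral>x. indicator {r..<1 + r} x *\<^sub>R f x \<partial>lborel)"
    by (subst lborel_integral_real_affine[where c=1 and t=r])
       (auto simp: indicator_def add.commute intro!: Bochner_Integration.integral_cong)
  also have "\<dots> = (\<integral>x. indicator {r..<1} x *\<^sub>R f x + indicator {1..<1 + r} x *\<^sub>R f x \<partial>lborel)"
    using r by (intro Bochner_Integration.integral_cong) (auto simp: indicator_def)
  also have "\<dots> = (\<integral>x. indicator {r..<1} x *\<^sub>R f x \<partial>lborel) + (\<integral>x. indicator {1..<1 + r} x *\<^sub>R f x \<partial>lborel)"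
    by (rule Bochner_Integration.integral_add[OF int int])
  also have "(\<integral>x. indicator {1..<1 + r} x *\<^sub>R f x \<partial>lborel) = (\<integral>x. indicator {0..<r} x *\<^sub>R f x \<partial>lborel)"
    using periodic
    by (subst lborel_integral_real_affine[where c=1 and t=1])
       (auto simp: indicator_def add.commute intro!: Bochner_Integration.integral_cong)
  also have "(\<integral>x. indicator {r..<1} x *\<^sub>R f x \<partial>lborel) + \<dots> =
      (\<integral>x. indicator {r..<1} x *\<^sub>R f x + indicator {0..<r} x *\<^sub>R f x \<partial>lborel)"
    by (rule Bochner_Integration.integral_add[OF int int, symmetric])
  also have "\<dots> = (\<integral>x. indicator {0..<1} x *\<^sub>R f x \<partial>lborel)"
    using r by (intro Bochner_Integration.integral_cong) (auto simp: indicator_def)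
  finally show ?thesis by (simp add: integral_circle_measure)
qed

lemma floor_shift_eq_frac: "real_of_int \<lfloor>x + s\<rfloor> - real_of_int \<lfloor>x\<rfloor> = s - (frac (x + s) - frac x)"
  by (simp add: frac_def)

lemma measurable_frac [measurable]: "frac \<in> borel_measurable (borel :: real measure)"
  unfolding frac_def [abs_def] by measurable

lemma abs_floor_diff_le: "\<bar>real_of_int \<lfloor>x\<rfloor> - real_of_int \<lfloor>y\<rfloor>\<bar> \<le> \<bar>x - y\<bar> + 1"
  by linarith

text \<open>
  The increment of the floor function is \<open>s\<close> minus the increment of the fractional part, and the
  latter has mean zero by translation invariance.
\<close>

lemma integral_floor_increment:
  assumes "0 \<le> s"
  shows "(\<integral>x. \<bar>real_of_int \<lfloor>x + s\<rfloor> - real_of_int \<lfloor>x\<rfloor>\<bar> \<partial>circle_measure) = s"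
proof -
  have i: "integrable circle_measure (\<lambda>x. frac (x + s))" for s :: real
    by (rule integrable_circle_bounded[where B=1]) (auto simp: frac_lt_1 less_imp_le)
  have "(\<integral>x. \<bar>real_of_int \<lfloor>x + s\<rfloor> - real_of_int \<lfloor>x\<rfloor>\<bar> \<partial>circle_measure)
      = (\<integral>x. s - (frac (x + s) - frac x) \<partial>circle_measure)"
    using assms by (simp add: floor_shift_eq_frac [symmetric] floor_mono)
  also have "\<dots> = s - ((\<integral>x. frac (x + s) \<partial>circle_measure) - (\<integral>x. frac x \<partial>circle_measure))"
    using i[of s] i[of 0] by (simp add: circle.prob_space del: space_circle_measure)
  also have "(\<integral>x. frac (x + s) \<partial>circle_measure) = (\<integral>x. frac x \<partial>circle_measure)"
    by (rule integral_circle_shift[where B=1]) (auto simp: frac_lt_1 less_imp_le frac_1_eq)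
  finally show ?thesis by simp
qed

lemma integrable_floor_diff:
  "integrable circle_measure (\<lambda>x. \<bar>real_of_int \<lfloor>c * x + a\<rfloor> - real_of_int \<lfloor>c * x + b\<rfloor>\<bar>)"
  by (rule integrable_circle_bounded[where B="\<bar>a - b\<bar> + 1"])
     (use abs_floor_diff_le[of "c * x + a" "c * x + b" for x] in auto)

lemma integral_floor_diff:
  "(\<integral>x. \<bar>real_of_int \<lfloor>x + a\<rfloor> - real_of_int \<lfloor>x + b\<rfloor>\<bar> \<partial>circle_measure) = \<bar>a - b\<bar>"
proof -
  have *: "(\<integral>x. \<bar>real_of_int \<lfloor>x + a\<rfloor> - real_of_int \<lfloor>x + b\<rfloor>\<bar> \<partial>circle_measure) = a - b" if "b \<le> a" for a b :: real
  proof -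
    let ?f = "\<lambda>x. \<bar>real_of_int \<lfloor>x + (a - b)\<rfloor> - real_of_int \<lfloor>x\<rfloor>\<bar>"
    have "\<lfloor>x + 1 + (a - b)\<rfloor> = \<lfloor>x + (a - b)\<rfloor> + 1" for x by linarith
    then have "?f (x + 1) = ?f x" for x by simp
    then have "(\<integral>x. ?f (x + b) \<partial>circle_measure) = (\<integral>x. ?f x \<partial>circle_measure)"
      using abs_floor_diff_le[of "x + (a - b)" x for x]
      by (intro integral_circle_shift[where B="\<bar>a - b\<bar> + 1"]) auto
    with integral_floor_increment[of "a - b"] that show ?thesis
      by (simp add: add.assoc)
  qed
  show ?thesis
    using *[of a b] *[of b a] by (cases "b \<le> a") (auto simp: abs_minus_commute)
qed

text \<open>
  Hermite's identity. The difference of the two sides is periodic with period \<open>1/q\<close> and vanishes on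
  \<open>[0, 1/q)\<close>.
\<close>

lemma floor_hermite:
  fixes y :: real
  assumes "q > 0"
  shows "(\<Sum>j<q. \<lfloor>y + real j / real q\<rfloor>) = \<lfloor>real q * y\<rfloor>"
proof -
  define g where "g y = (\<Sum>j<q. \<lfloor>y + real j / real q\<rfloor>) - \<lfloor>real q * y\<rfloor>" for y :: real
  define e where "e = 1 / real q"
  have step: "g (y + e) = g y" for y
  proof -
    have "(\<Sum>j<q. \<lfloor>y + e + real j / real q\<rfloor>) = (\<Sum>j<q. \<lfloor>y + real (Suc j) / real q\<rfloor>)"
      by (simp add: e_def add_divide_distrib algebra_simps)
    also have "\<dots> = (\<Sum>j<q. \<lfloor>y + real j / real q\<rfloor>) + \<lfloor>y + real q / real q\<rfloor> - \<lfloor>y + real 0 / real q\<rfloor>"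
      using sum.lessThan_Suc_shift[of "\<lambda>j. \<lfloor>y + real j / real q\<rfloor>" q]
        sum.lessThan_Suc[of "\<lambda>j. \<lfloor>y + real j / real q\<rfloor>" q] by linarith
    also have "\<dots> = (\<Sum>j<q. \<lfloor>y + real j / real q\<rfloor>) + 1"
      using \<open>q > 0\<close> by simp
    finally show ?thesis
      using \<open>q > 0\<close> by (simp add: g_def e_def distrib_left)
  qed
  have zero: "g y = 0" if "0 \<le> y" "y < e" for y
  proof -
    have "\<lfloor>y + real j / real q\<rfloor> = 0" if "j < q" for j
    proof -
      have "y + real j / real q < e + real j / real q" using \<open>y < e\<close> by simp
      also have "\<dots> = real (Suc j) / real q" by (simp add: e_def add_divide_distrib)
      also have "\<dots> \<le> 1" using that \<open>q > 0\<close> by simp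
      finally show ?thesis using \<open>0 \<le> y\<close> by (simp add: floor_eq_iff)
    qed
    moreover have "\<lfloor>real q * y\<rfloor> = 0"
      using that \<open>q > 0\<close> by (simp add: floor_eq_iff e_def field_simps)
    ultimately show ?thesis by (simp add: g_def)
  qed
  have per: "g (y + of_int n * e) = g y" for n y
  proof -
    have "g ((z + 1) * e) = g (z * e)" for z
      using step[of "z * e"] by (simp add: distrib_right)
    from periodic_int[of "\<lambda>z. g (z * e)" "y / e" n, OF this] show ?thesis
      using \<open>q > 0\<close> by (simp add: distrib_right e_def add_divide_distrib)
  qed
  have "y = frac (y / e) * e + of_int \<lfloor>y / e\<rfloor> * e"
    using \<open>q > 0\<close> by (simp add: frac_def e_def diff_divide_distrib)
  then have "g y = g (frac (y / e) * e)"
    using per by metis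
  also have "\<dots> = 0"
    using \<open>q > 0\<close> frac_lt_1[of "y / e"] by (intro zero) (simp_all add: e_def divide_strict_right_mono)
  finally show ?thesis by (simp add: g_def)
qed

text \<open>
  Hermite's identity writes the dilated floor function as a sum of \<open>q\<close> undilated ones, each of which
  contributes \<open>\<bar>a - b\<bar> / q\<close>.
\<close>

lemma integral_floor_diff_dilated:
  assumes "q > 0"
  shows "(\<integral>x. \<bar>real_of_int \<lfloor>real q * x + a\<rfloor> - real_of_int \<lfloor>real q * x + b\<rfloor>\<bar> \<partial>circle_measure) \<le> \<bar>a - b\<bar>"
proof -
  let ?d = "\<lambda>x j. \<bar>real_of_int \<lfloor>x + (a + real j) / real q\<rfloor> - real_of_int \<lfloor>x + (b + real j) / real q\<rfloor>\<bar>"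
  have h: "real_of_int \<lfloor>real q * x + a\<rfloor> = (\<Sum>j<q. real_of_int \<lfloor>x + (a + real j) / real q\<rfloor>)" for x a
    using floor_hermite[OF assms, of "x + a / real q"] assms
    by (simp add: distrib_left add_divide_distrib add.assoc flip: of_int_sum)
  have i: "integrable circle_measure (\<lambda>x. ?d x j)" for j
    using integrable_floor_diff[of 1 "(a + real j) / real q" "(b + real j) / real q"] by simp
  have "(\<integral>x. \<bar>real_of_int \<lfloor>real q * x + a\<rfloor> - real_of_int \<lfloor>real q * x + b\<rfloor>\<bar> \<partial>circle_measure)
      \<le> (\<integral>x. (\<Sum>j<q. ?d x j) \<partial>circle_measure)"
  proof (rule integral_mono)
    show "\<bar>real_of_int \<lfloor>real q * x + a\<rfloor> - real_of_int \<lfloor>real q * x + b\<rfloor>\<bar> \<le> (\<Sum>j<q. ?d x j)" for x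
      unfolding h sum_subtractf [symmetric] by (rule sum_abs)
  qed (use i integrable_floor_diff in auto)
  also have "\<dots> = (\<Sum>j<q. \<bar>(a + real j) / real q - (b + real j) / real q\<bar>)"
    using i by (simp add: integral_floor_diff)
  also have "\<dots> = \<bar>a - b\<bar>"
    using assms by (simp add: diff_divide_distrib [symmetric])
  finally show ?thesis .
qed

section \<open>One block of the ergodic sum\<close>

definition square_wave :: "real \<Rightarrow> real" where
  "square_wave y = 2 * (real_of_int \<lfloor>y\<rfloor> - real_of_int \<lfloor>y - 1/2\<rfloor>) - 1"

lemma square_wave_values: "square_wave y = 1 \<or> square_wave y = -1"
proof -
  have "\<lfloor>y - 1/2\<rfloor> = \<lfloor>y\<rfloor> \<or> \<lfloor>y - 1/2\<rfloor> = \<lfloor>y\<rfloor> - 1" by linarith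
  then show ?thesis by (auto simp: square_wave_def)
qed

lemma square_wave_half_period: "square_wave (y + 1/2) = - square_wave y"
proof -
  have "\<lfloor>y + 1/2\<rfloor> = \<lfloor>y - 1/2\<rfloor> + 1" by linarith
  then show ?thesis by (simp add: square_wave_def)
qed

lemma measurable_square_wave [measurable]: "square_wave \<in> borel_measurable borel"
  unfolding square_wave_def [abs_def] by measurable

definition arc_difference :: "real \<Rightarrow> real \<Rightarrow> real" where
  "arc_difference c x = circle_indicator {0..c} x - circle_indicator {1/2..1/2 + c} x"

lemma phi1_eq: "phi1 \<alpha> = arc_difference (\<alpha> / 2)"
  and phi2_eq: "phi2 \<alpha> = arc_difference (1/2 - \<alpha> / 2)"
  by (simp_all add: fun_eq_iff phi1_def phi2_def arc_difference_def)

text \<open>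
  For \<open>0 < c < 1/2\<close> the same function as \<open>arc_difference c\<close>, up to the end points of the arcs. In this
  form a change of \<open>c\<close> or of \<open>x\<close> is a change of the arguments of floor functions, and Hermite's
  identity sums it over a grid.
\<close>

definition floor_arc_difference :: "real \<Rightarrow> real \<Rightarrow> real" where
  "floor_arc_difference c x = \<lfloor>x\<rfloor> - \<lfloor>x - c\<rfloor> - \<lfloor>x - 1/2\<rfloor> + \<lfloor>x - 1/2 - c\<rfloor>"

lemma measurable_arc_difference [measurable]: "arc_difference c \<in> borel_measurable borel"
  unfolding arc_difference_def [abs_def] circle_indicator_def by measurable

lemma measurable_floor_arc_difference [measurable]: "floor_arc_difference c \<in> borel_measurable borel"
  unfolding floor_arc_difference_def [abs_def] by measurable

lemma arc_difference_periodic: "arc_difference c (x + 1) = arc_difference c x"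
  by (simp add: arc_difference_def circle_indicator_def frac_1_eq)

lemma floor_arc_difference_periodic: "floor_arc_difference c (x + 1) = floor_arc_difference c x"
proof -
  have "\<lfloor>x + 1 - c\<rfloor> = \<lfloor>x - c\<rfloor> + 1" "\<lfloor>x + 1 - 1/2\<rfloor> = \<lfloor>x - 1/2\<rfloor> + 1"
    "\<lfloor>x + 1 - 1/2 - c\<rfloor> = \<lfloor>x - 1/2 - c\<rfloor> + 1" by linarith+
  then show ?thesis by (simp add: floor_arc_difference_def)
qed

lemma arc_difference_bounded: "\<bar>arc_difference c x\<bar> \<le> 1"
  by (simp add: arc_difference_def circle_indicator_def indicator_def)

lemma floor_arc_difference_bounded: "\<bar>floor_arc_difference c x\<bar> \<le> 1"
proof -
  have "\<bar>\<lfloor>x\<rfloor> - \<lfloor>x - c\<rfloor> - \<lfloor>x - 1/2\<rfloor> + \<lfloor>x - 1/2 - c\<rfloor>\<bar> \<le> 1" by linarith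
  then show ?thesis unfolding floor_arc_difference_def by linarith
qed

lemma arc_difference_eq_floor:
  assumes "0 < c" "c < 1/2" "0 \<le> x" "x < 1" "x \<noteq> c" "x \<noteq> 1/2 + c"
  shows "arc_difference c x = floor_arc_difference c x"
proof -
  have "frac x = x" using assms by (simp add: frac_eq)
  moreover have "\<lfloor>x\<rfloor> = 0" using assms by linarith
  moreover have "\<lfloor>x - c\<rfloor> = (if x < c then -1 else 0)" using assms by (auto simp: floor_eq_iff)
  moreover have "\<lfloor>x - 1/2\<rfloor> = (if x < 1/2 then -1 else 0)" using assms by (auto simp: floor_eq_iff)
  moreover have "\<lfloor>x - 1/2 - c\<rfloor> = (if x < 1/2 + c then -1 else 0)" using assms by (auto simp: floor_eq_iff)
  ultimately show ?thesis
    using assms by (auto simp: arc_difference_def floor_arc_difference_def circle_indicator_def indicator_def)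
qed

lemma AE_circle_neq: "AE x in circle_measure. x \<noteq> (c::real)"
  using AE_lborel_singleton[of c] unfolding circle_measure_def by (auto simp: AE_restrict_space_iff elim: eventually_mono)

lemma integral_arc_difference_floor:
  assumes "0 < c" "c < 1/2"
  shows "(\<integral>x. \<bar>arc_difference c (x + s) - floor_arc_difference c (x + s)\<bar> \<partial>circle_measure) = 0"
proof -
  have "(\<integral>x. \<bar>arc_difference c (x + s) - floor_arc_difference c (x + s)\<bar> \<partial>circle_measure) =
      (\<integral>x. \<bar>arc_difference c x - floor_arc_difference c x\<bar> \<partial>circle_measure)"
  proof (rule integral_circle_shift[where B=2 and f="\<lambda>x. \<bar>arc_difference c x - floor_arc_difference c x\<bar>"])
    show "norm \<bar>arc_difference c x - floor_arc_difference c x\<bar> \<le> 2" for x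
      using arc_difference_bounded[of c x] floor_arc_difference_bounded[of c x] by simp
  qed (simp_all add: arc_difference_periodic floor_arc_difference_periodic)
  also have "\<dots> = 0"
  proof (rule integral_eq_zero_AE)
    show "AE x in circle_measure. \<bar>arc_difference c x - floor_arc_difference c x\<bar> = 0"
      using AE_circle_neq[of c] AE_circle_neq[of "1/2 + c"] AE_space
      by eventually_elim (use assms arc_difference_eq_floor in auto)
  qed
  finally show ?thesis .
qed

lemma integrable_floor_arc_difference:
  "integrable circle_measure (\<lambda>x. floor_arc_difference c (x + s))"
  using floor_arc_difference_bounded by (intro integrable_circle_bounded[where B=1]) auto

lemma integrable_arc_difference:
  "integrable circle_measure (\<lambda>x. arc_difference c (x + s))"
  using arc_difference_bounded by (intro integrable_circle_bounded[where B=1]) auto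

lemma integral_floor_arc_difference_perturb:
  "(\<integral>x. \<bar>floor_arc_difference c (x + s) - floor_arc_difference c' (x + s')\<bar> \<partial>circle_measure)
     \<le> 4 * \<bar>s - s'\<bar> + 2 * \<bar>c - c'\<bar>"
proof -
  let ?d = "\<lambda>a b x. \<bar>real_of_int \<lfloor>x + a\<rfloor> - real_of_int \<lfloor>x + b\<rfloor>\<bar>"
  have i: "integrable circle_measure (?d a b)" for a b
    using integrable_floor_diff[of 1 a b] by simp
  have "(\<integral>x. \<bar>floor_arc_difference c (x + s) - floor_arc_difference c' (x + s')\<bar> \<partial>circle_measure)
      \<le> (\<integral>x. ?d s s' x + ?d (s - c) (s' - c') x + ?d (s - 1/2) (s' - 1/2) x
             + ?d (s - 1/2 - c) (s' - 1/2 - c') x \<partial>circle_measure)"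
  proof (rule integral_mono)
    show "integrable circle_measure (\<lambda>x. \<bar>floor_arc_difference c (x + s) - floor_arc_difference c' (x + s')\<bar>)"
      by (intro integrable_abs Bochner_Integration.integrable_diff integrable_floor_arc_difference)
    show "integrable circle_measure (\<lambda>x. ?d s s' x + ?d (s - c) (s' - c') x + ?d (s - 1/2) (s' - 1/2) x
             + ?d (s - 1/2 - c) (s' - 1/2 - c') x)"
      by (intro Bochner_Integration.integrable_add i)
    show "\<bar>floor_arc_difference c (x + s) - floor_arc_difference c' (x + s')\<bar> \<le>
        ?d s s' x + ?d (s - c) (s' - c') x + ?d (s - 1/2) (s' - 1/2) x + ?d (s - 1/2 - c) (s' - 1/2 - c') x" for x
      unfolding floor_arc_difference_def by (simp add: add_diff_eq)
  qed
  also have "\<dots> = \<bar>s - s'\<bar> + \<bar>(s - c) - (s' - c')\<bar> + \<bar>(s - 1/2) - (s' - 1/2)\<bar>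
      + \<bar>(s - 1/2 - c) - (s' - 1/2 - c')\<bar>"
    by (simp only: Bochner_Integration.integral_add Bochner_Integration.integrable_add i integral_floor_diff)
  also have "\<dots> \<le> 4 * \<bar>s - s'\<bar> + 2 * \<bar>c - c'\<bar>"
  proof -
    have "B \<le> A + C \<Longrightarrow> A + B + A + B \<le> 4 * A + 2 * C" for A B C :: real by linarith
    moreover have "(s - 1/2) - (s' - 1/2) = s - s'" "(s - 1/2 - c) - (s' - 1/2 - c') = (s - c) - (s' - c')"
      by simp_all
    moreover have "\<bar>(s - c) - (s' - c')\<bar> \<le> \<bar>s - s'\<bar> + \<bar>c - c'\<bar>" by linarith
    ultimately show ?thesis by metis
  qed
  finally show ?thesis .
qed

text \<open>
  Since \<open>p\<close> is invertible modulo \<open>q\<close>, the rotation by \<open>p/q\<close> visits each point of the grid of step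
  \<open>1/q\<close> once.
\<close>

lemma sum_rotation_rational:
  fixes h :: "real \<Rightarrow> 'a::comm_monoid_add"
  assumes "coprime p q" "q > 0" and periodic: "\<And>x. h (x + 1) = h x"
  shows "(\<Sum>j<q. h (x + real j * (real p / real q))) = (\<Sum>j<q. h (x + real j / real q))"
proof -
  have inj: "inj_on (\<lambda>j. j * p mod q) {..<q}"
  proof (rule linorder_inj_onI)
    fix i j assume ij: "i < j" "i \<in> {..<q}" "j \<in> {..<q}"
    show "i * p mod q \<noteq> j * p mod q"
    proof
      assume "i * p mod q = j * p mod q"
      then have "q dvd j * p - i * p"
        using ij by (intro mod_eq_dvd_iff_nat[THEN iffD1]) auto
      then have "q dvd j - i"
        using assms(1) by (simp add: diff_mult_distrib [symmetric] coprime_dvd_mult_left_iff coprime_commute)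
      with ij show False by (auto dest: dvd_imp_le)
    qed
  qed auto
  have "(\<lambda>j. j * p mod q) ` {..<q} = {..<q}"
    by (rule card_subset_eq) (use assms(2) inj in \<open>auto simp: card_image\<close>)
  with inj have bij: "bij_betw (\<lambda>j. j * p mod q) {..<q} {..<q}"
    by (simp add: bij_betw_def)
  have "h (x + real j * (real p / real q)) = h (x + real (j * p mod q) / real q)" for j
  proof -
    define K M where "K = j * p div q" and "M = j * p mod q"
    have "j * p = K * q + M" by (simp add: K_def M_def)
    then have "real j * real p = real K * real q + real M"
      by (metis of_nat_add of_nat_mult)
    then have "real j * (real p / real q) = real (j * p mod q) / real q + of_int (int (j * p div q))"
      unfolding K_def [symmetric] M_def [symmetric] using assms(2) by (simp add: add_divide_distrib)
    then show ?thesis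
      using periodic_int[of h "x + real (j * p mod q) / real q" "int (j * p div q)", OF periodic] by (simp add: add.assoc)
  qed
  then show ?thesis
    using sum.reindex_bij_betw[OF bij, of "\<lambda>j. h (x + real j / real q)"] by simp
qed

text \<open>
  Hermite's identity turns the four floor functions into those of \<open>q x\<close>, \<open>q x - m/2\<close>, \<open>q x - q/2\<close> and
  \<open>q x - q/2 - m/2\<close>. As \<open>q\<close> is odd, these involve only \<open>\<lfloor>q x\<rfloor>\<close> and \<open>\<lfloor>q x - 1/2\<rfloor>\<close>: they cancel for even
  \<open>m\<close>, and add up to a square wave for odd \<open>m\<close>.
\<close>

lemma sum_floor_arc_difference:
  assumes "odd q"
  shows "(\<Sum>j<q. floor_arc_difference (real_of_int m / (2 * real q)) (x + real j / real q)) =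
    (if odd m then square_wave (real q * x) else 0)"
proof -
  have "q > 0" using assms by (rule odd_pos)
  define y where "y = real q * x"
  define c where "c = real_of_int m / (2 * real q)"
  have h: "(\<Sum>j<q. real_of_int \<lfloor>x + real j / real q - a\<rfloor>) = real_of_int \<lfloor>y - real q * a\<rfloor>" for a
    using floor_hermite[OF \<open>q > 0\<close>, of "x - a"]
    by (simp add: y_def right_diff_distrib add_diff_eq diff_add_eq flip: of_int_sum)
  obtain l where l: "q = 2 * l + 1" using assms by (elim oddE)
  have qc: "real q * c = real_of_int m / 2" using \<open>q > 0\<close> by (simp add: c_def)
  have "(\<Sum>j<q. floor_arc_difference c (x + real j / real q)) =
     real_of_int \<lfloor>y\<rfloor> - real_of_int \<lfloor>y - real q * c\<rfloor> - real_of_int \<lfloor>y - real q * (1/2)\<rfloor>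
       + real_of_int \<lfloor>y - real q * (1/2 + c)\<rfloor>"
    unfolding floor_arc_difference_def
    using h[of 0] h[of c] h[of "1/2"] h[of "1/2 + c"] by (simp add: sum.distrib sum_subtractf diff_diff_eq)
  also have "\<dots> = real_of_int (\<lfloor>y\<rfloor> - \<lfloor>y - m / 2\<rfloor> - \<lfloor>y - 1/2\<rfloor> + \<lfloor>y - 1/2 - m / 2\<rfloor>)"
  proof -
    have "real q * (1/2) = real l + 1/2" by (simp add: l)
    then have "\<lfloor>y - real q * (1/2)\<rfloor> = \<lfloor>y - 1/2\<rfloor> - int l"
      "\<lfloor>y - real q * (1/2 + c)\<rfloor> = \<lfloor>y - 1/2 - m / 2\<rfloor> - int l"
      unfolding distrib_left qc by linarith+
    then show ?thesis by (simp add: qc)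
  qed
  also have "\<dots> = (if odd m then square_wave y else 0)"
  proof (cases "odd m")
    case True
    then obtain n where "m = 2 * n + 1" by (elim oddE)
    then have "\<lfloor>y - m / 2\<rfloor> = \<lfloor>y - 1/2\<rfloor> - n" "\<lfloor>y - 1/2 - m / 2\<rfloor> = \<lfloor>y\<rfloor> - n - 1" by linarith+
    with True show ?thesis by (simp add: square_wave_def)
  next
    case False
    then obtain n where "m = 2 * n" by (auto elim: evenE)
    then have "\<lfloor>y - m / 2\<rfloor> = \<lfloor>y\<rfloor> - n" "\<lfloor>y - 1/2 - m / 2\<rfloor> = \<lfloor>y - 1/2\<rfloor> - n" by linarith+
    with False show ?thesis by simp
  qed
  finally show ?thesis by (simp add: c_def y_def)
qed

lemma square_wave_periodic: "square_wave (y + real n) = square_wave y"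
proof -
  have "\<lfloor>y + real n - 1/2\<rfloor> = \<lfloor>y - 1/2\<rfloor> + int n" by linarith
  then show ?thesis by (simp add: square_wave_def)
qed

text \<open>
  In the \<open>j\<close>-th term the point moves by \<open>j \<bar>\<alpha> - p/q\<bar>\<close> and the length of the arcs by at most
  \<open>\<bar>\<alpha> - p/q\<bar> / 2\<close>. The term therefore changes by at most \<open>(4 j + 1) \<bar>\<alpha> - p/q\<bar>\<close> in \<open>L\<^sup>1\<close>, which is
  at most \<open>4 q \<bar>\<alpha> - p/q\<bar>\<close>.
\<close>

lemma rotation_sum_arc_difference:
  assumes "0 < c" "c < 1/2" "odd q" "coprime p q"
    and c: "\<bar>c - real_of_int m / (2 * real q)\<bar> \<le> \<bar>\<alpha> - real p / real q\<bar> / 2"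
  shows "(\<integral>x. \<bar>rotation_sum \<alpha> (arc_difference c) q (x + s)
               - (if odd m then square_wave (real q * (x + s)) else 0)\<bar> \<partial>circle_measure)
    \<le> 4 * (real q)\<^sup>2 * \<bar>\<alpha> - real p / real q\<bar>"
proof -
  have "q > 0" using \<open>odd q\<close> by (rule odd_pos)
  define \<eta> where "\<eta> = \<bar>\<alpha> - real p / real q\<bar>"
  define c' where "c' = real_of_int m / (2 * real q)"
  let ?f = "\<lambda>j x. arc_difference c (x + (s + real j * \<alpha>))"
  let ?g = "\<lambda>j x. floor_arc_difference c (x + (s + real j * \<alpha>))"
  let ?h = "\<lambda>j x. floor_arc_difference c' (x + (s + real j * (real p / real q)))"
  have i: "integrable circle_measure (\<lambda>x. \<bar>?f j x - ?g j x\<bar>)" "integrable circle_measure (\<lambda>x. \<bar>?g j x - ?h j x\<bar>)"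
    "integrable circle_measure (\<lambda>x. ?f j x - ?h j x)" for j
    by (intro integrable_abs Bochner_Integration.integrable_diff integrable_floor_arc_difference integrable_arc_difference)+
  have eq: "rotation_sum \<alpha> (arc_difference c) q (x + s) - (if odd m then square_wave (real q * (x + s)) else 0)
      = (\<Sum>j<q. ?f j x - ?h j x)" for x
    using sum_rotation_rational[OF assms(4) \<open>q > 0\<close>, of "floor_arc_difference c'" "x + s"]
      sum_floor_arc_difference[OF assms(3), of m "x + s"]
    by (simp add: rotation_sum_def c'_def floor_arc_difference_periodic sum_subtractf add.assoc)
  have "(\<integral>x. \<bar>\<Sum>j<q. ?f j x - ?h j x\<bar> \<partial>circle_measure)
      \<le> (\<integral>x. (\<Sum>j<q. \<bar>?f j x - ?g j x\<bar> + \<bar>?g j x - ?h j x\<bar>) \<partial>circle_measure)"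
  proof (rule integral_mono)
    show "\<bar>\<Sum>j<q. ?f j x - ?h j x\<bar> \<le> (\<Sum>j<q. \<bar>?f j x - ?g j x\<bar> + \<bar>?g j x - ?h j x\<bar>)" for x
      by (rule order_trans[OF sum_abs sum_mono]) simp
  qed (intro integrable_abs Bochner_Integration.integrable_sum Bochner_Integration.integrable_add i)+
  also have "\<dots> = (\<Sum>j<q. (\<integral>x. \<bar>?f j x - ?g j x\<bar> \<partial>circle_measure) + (\<integral>x. \<bar>?g j x - ?h j x\<bar> \<partial>circle_measure))"
    using i by (simp del: space_circle_measure)
  also have "\<dots> \<le> (\<Sum>j<q. 4 * real q * \<eta>)"
  proof (rule sum_mono)
    fix j assume "j \<in> {..<q}"
    then have "real j + 1 \<le> real q" by auto
    then have "(4 * real j + 1) * \<eta> \<le> 4 * real q * \<eta>"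
      by (intro mult_right_mono) (auto simp: \<eta>_def)
    moreover have "\<bar>s + real j * \<alpha> - (s + real j * (real p / real q))\<bar> = real j * \<eta>"
    proof -
      have "s + real j * \<alpha> - (s + real j * (real p / real q)) = real j * (\<alpha> - real p / real q)"
        by (simp add: right_diff_distrib)
      then show ?thesis by (simp only: \<eta>_def abs_mult abs_of_nat)
    qed
    ultimately show "(\<integral>x. \<bar>?f j x - ?g j x\<bar> \<partial>circle_measure) + (\<integral>x. \<bar>?g j x - ?h j x\<bar> \<partial>circle_measure) \<le> 4 * real q * \<eta>"
      using integral_arc_difference_floor[OF assms(1,2), of "s + real j * \<alpha>"] c
        integral_floor_arc_difference_perturb[of c "s + real j * \<alpha>" c' "s + real j * (real p / real q)"]
      by (simp add: \<eta>_def [symmetric] c'_def [symmetric] distrib_right)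
  qed
  also have "\<dots> = 4 * (real q)\<^sup>2 * \<eta>" by (simp add: power2_eq_square)
  finally show ?thesis by (simp add: eq \<eta>_def)
qed

corollary rotation_sum_phi1:
  assumes "0 < \<alpha>" "\<alpha> < 1" "odd q" "coprime p q"
  shows "(\<integral>x. \<bar>rotation_sum \<alpha> (phi1 \<alpha>) q (x + s)
               - (if odd p then square_wave (real q * (x + s)) else 0)\<bar> \<partial>circle_measure)
    \<le> 4 * (real q)\<^sup>2 * \<bar>\<alpha> - real p / real q\<bar>"
proof -
  have "\<alpha> / 2 - real_of_int (int p) / (2 * real q) = (\<alpha> - real p / real q) / 2"
    by (simp add: diff_divide_distrib)
  then have "\<bar>\<alpha> / 2 - real_of_int (int p) / (2 * real q)\<bar> \<le> \<bar>\<alpha> - real p / real q\<bar> / 2"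
    by (simp only: abs_divide)
  from rotation_sum_arc_difference[OF _ _ assms(3,4) this, of s] assms show ?thesis
    by (simp add: phi1_eq)
qed

text \<open>
  Here the length of the arcs is close to \<open>(q - p) / (2 q)\<close>; as \<open>q\<close> is odd, \<open>q - p\<close> is odd exactly when
  \<open>p\<close> is even.
\<close>

corollary rotation_sum_phi2:
  assumes "0 < \<alpha>" "\<alpha> < 1" "odd q" "coprime p q"
  shows "(\<integral>x. \<bar>rotation_sum \<alpha> (phi2 \<alpha>) q (x + s)
               - (if even p then square_wave (real q * (x + s)) else 0)\<bar> \<partial>circle_measure)
    \<le> 4 * (real q)\<^sup>2 * \<bar>\<alpha> - real p / real q\<bar>"
proof -
  have "1/2 - \<alpha> / 2 - real_of_int (int q - int p) / (2 * real q) = - (\<alpha> - real p / real q) / 2"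
    using odd_pos[OF assms(3)] by (simp add: diff_divide_distrib)
  then have "\<bar>1/2 - \<alpha> / 2 - real_of_int (int q - int p) / (2 * real q)\<bar> \<le> \<bar>\<alpha> - real p / real q\<bar> / 2"
    by (simp only: abs_divide abs_minus_cancel)
  from rotation_sum_arc_difference[OF _ _ assms(3,4) this, of s] assms show ?thesis
    by (simp add: phi2_eq)
qed

section \<open>Continued fraction convergents\<close>

context
  fixes \<alpha> :: real
  assumes irrational: "0 < \<alpha>" "\<alpha> < 1" "\<alpha> \<notin> \<rat>"
begin

lemma cf_remainder_irrational: "cf_remainder \<alpha> n \<notin> \<rat>"
proof (induction n)
  case 0
  then show ?case using irrational by (simp add: frac_eq)
next
  case (Suc n)
  have "1 / cf_remainder \<alpha> n \<notin> \<rat>"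
  proof
    assume "1 / cf_remainder \<alpha> n \<in> \<rat>"
    then have "inverse (1 / cf_remainder \<alpha> n) \<in> \<rat>" by (rule Rats_inverse)
    with Suc show False by (simp only: inverse_divide) simp
  qed
  moreover have "1 / cf_remainder \<alpha> n = of_int \<lfloor>1 / cf_remainder \<alpha> n\<rfloor> + cf_remainder \<alpha> (Suc n)"
    by (simp add: frac_def)
  ultimately show ?case
    by (metis Rats_add Rats_of_int)
qed

lemma cf_remainder_bounds: "0 < cf_remainder \<alpha> n" "cf_remainder \<alpha> n < 1"
proof -
  have "cf_remainder \<alpha> n \<noteq> 0" using cf_remainder_irrational[of n] by auto
  moreover have "0 \<le> cf_remainder \<alpha> n \<and> cf_remainder \<alpha> n < 1" by (cases n) (auto simp: frac_lt_1)
  ultimately show "0 < cf_remainder \<alpha> n" "cf_remainder \<alpha> n < 1" by auto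
qed

lemma inverse_cf_remainder:
  "1 / cf_remainder \<alpha> n = real (cf_quotient \<alpha> (Suc n)) + cf_remainder \<alpha> (Suc n)"
  using cf_remainder_bounds(1)[of n] by (simp add: frac_def)

lemma cf_quotient_pos: "cf_quotient \<alpha> (Suc n) \<ge> 1"
  using cf_remainder_bounds[of n] by (simp add: le_nat_iff le_floor_iff)

lemma cf_denominator_pos: "cf_denominator \<alpha> n \<ge> 1"
  by (induction n rule: induct_nat_012)
     (use cf_quotient_pos in \<open>auto simp del: cf_quotient.simps simp: Suc_le_eq\<close>)

lemma cf_denominator_quotient_le:
  "cf_quotient \<alpha> (Suc n) * cf_denominator \<alpha> n \<le> cf_denominator \<alpha> (Suc n)"
  by (cases n) auto

lemma cf_denominator_Suc_le: "cf_denominator \<alpha> n \<le> cf_denominator \<alpha> (Suc n)"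
proof -
  have "1 * cf_denominator \<alpha> n \<le> cf_quotient \<alpha> (Suc n) * cf_denominator \<alpha> n"
    by (rule mult_le_mono1[OF cf_quotient_pos])
  also note cf_denominator_quotient_le
  finally show ?thesis by simp
qed

lemma cf_denominator_mono: "m \<le> n \<Longrightarrow> cf_denominator \<alpha> m \<le> cf_denominator \<alpha> n"
  by (rule lift_Suc_mono_le[of "cf_denominator \<alpha>", OF cf_denominator_Suc_le])

text \<open>
  The geometric growth bounds the sum of all slower frequencies by a multiple of the last one.
\<close>

lemma cf_denominator_double: "2 * cf_denominator \<alpha> n \<le> cf_denominator \<alpha> (Suc (Suc n))"
proof -
  have "1 * cf_denominator \<alpha> (Suc n) \<le> cf_quotient \<alpha> (Suc (Suc n)) * cf_denominator \<alpha> (Suc n)"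
    by (rule mult_le_mono1[OF cf_quotient_pos])
  then have "cf_denominator \<alpha> n \<le> cf_quotient \<alpha> (Suc (Suc n)) * cf_denominator \<alpha> (Suc n)"
    using cf_denominator_Suc_le[of n] by linarith
  then show ?thesis by (simp del: cf_quotient.simps)
qed

lemma cf_coprime: "coprime (cf_numerator \<alpha> n) (cf_denominator \<alpha> n)"
proof -
  have det: "\<bar>int (cf_numerator \<alpha> (Suc n)) * int (cf_denominator \<alpha> n)
      - int (cf_numerator \<alpha> n) * int (cf_denominator \<alpha> (Suc n))\<bar> = 1" for n
  proof (induction n)
    case (Suc n)
    then show ?case
      by (simp add: algebra_simps abs_minus_commute del: cf_quotient.simps)
  qed simp
  show ?thesis
  proof (rule coprimeI)
    fix d assume "d dvd cf_numerator \<alpha> n" "d dvd cf_denominator \<alpha> n"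
    then have "int d dvd int (cf_numerator \<alpha> (Suc n)) * int (cf_denominator \<alpha> n)
      - int (cf_numerator \<alpha> n) * int (cf_denominator \<alpha> (Suc n))"
      by (intro dvd_diff dvd_mult dvd_mult2) auto
    then have "int d dvd 1" using det[of n] by (metis dvd_abs_iff)
    then show "is_unit d" by simp
  qed
qed

definition cf_error :: "nat \<Rightarrow> real" where
  "cf_error n = real (cf_denominator \<alpha> n) * \<alpha> - real (cf_numerator \<alpha> n)"

lemma cf_error_Suc: "cf_error (Suc n) = - cf_remainder \<alpha> (Suc n) * cf_error n"
proof (induction n)
  case 0
  have "\<alpha> * (1 / cf_remainder \<alpha> 0) = \<alpha> * (real (cf_quotient \<alpha> 1) + cf_remainder \<alpha> 1)"
    using inverse_cf_remainder[of 0] by simp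
  moreover have "cf_remainder \<alpha> 0 = \<alpha>" using irrational by (simp add: frac_eq)
  ultimately have "real (cf_quotient \<alpha> 1) * \<alpha> - 1 = - cf_remainder \<alpha> 1 * \<alpha>"
    using irrational(1) by (simp add: algebra_simps del: cf_quotient.simps cf_remainder.simps)
  then show ?case by (simp add: cf_error_def del: cf_quotient.simps cf_remainder.simps)
next
  case (Suc n)
  let ?r = "cf_remainder \<alpha>" and ?a = "real (cf_quotient \<alpha> (Suc (Suc n)))"
  have "cf_error (Suc (Suc n)) = ?a * cf_error (Suc n) + cf_error n"
    by (simp add: cf_error_def algebra_simps del: cf_quotient.simps)
  moreover have "cf_error n = - (1 / ?r (Suc n)) * cf_error (Suc n)"
    using Suc cf_remainder_bounds(1)[of "Suc n"] by (simp del: cf_remainder.simps)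
  ultimately have "cf_error (Suc (Suc n)) = (?a - 1 / ?r (Suc n)) * cf_error (Suc n)"
    by (simp add: algebra_simps del: cf_quotient.simps cf_remainder.simps)
  then show ?case
    unfolding inverse_cf_remainder by simp
qed

text \<open>
  This is the determinant identity \<open>q\<^sub>n p\<^sub>n\<^sub>+\<^sub>1 - q\<^sub>n\<^sub>+\<^sub>1 p\<^sub>n = \<plusminus>1\<close>, stated for absolute values because
  consecutive errors have opposite signs.
\<close>

lemma cf_error_balance:
  "real (cf_denominator \<alpha> (Suc n)) * \<bar>cf_error n\<bar> + real (cf_denominator \<alpha> n) * \<bar>cf_error (Suc n)\<bar> = 1"
proof (induction n)
  case 0
  have "cf_error 0 = \<alpha>" "cf_error 1 = real (cf_quotient \<alpha> 1) * \<alpha> - 1"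
    by (simp_all add: cf_error_def del: cf_quotient.simps)
  moreover have "cf_error 1 < 0"
    using cf_error_Suc[of 0] cf_remainder_bounds(1)[of 1] \<open>cf_error 0 = \<alpha>\<close> irrational(1)
    by (simp add: mult_pos_pos del: cf_remainder.simps)
  ultimately show ?case using irrational(1) by (simp del: cf_quotient.simps)
next
  case (Suc n)
  let ?r = "cf_remainder \<alpha>" and ?a = "real (cf_quotient \<alpha> (Suc (Suc n)))"
  have r: "0 < ?r n" for n by (rule cf_remainder_bounds)
  have 1: "\<bar>cf_error (Suc m)\<bar> = ?r (Suc m) * \<bar>cf_error m\<bar>" for m
    unfolding cf_error_Suc[of m] abs_mult using r[of "Suc m"] by (simp del: cf_remainder.simps)
  have "\<bar>cf_error n\<bar> = (1 / ?r (Suc n)) * \<bar>cf_error (Suc n)\<bar>"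
    using r[of "Suc n"] by (simp add: 1 del: cf_remainder.simps)
  also have "\<dots> = ?a * \<bar>cf_error (Suc n)\<bar> + \<bar>cf_error (Suc (Suc n))\<bar>"
    unfolding inverse_cf_remainder by (simp add: 1 distrib_right del: cf_remainder.simps cf_quotient.simps)
  finally show ?case
    using Suc by (simp add: algebra_simps del: cf_quotient.simps)
qed

lemma cf_approximation:
  "(real (cf_denominator \<alpha> n))\<^sup>2 * \<bar>\<alpha> - real (cf_numerator \<alpha> n) / real (cf_denominator \<alpha> n)\<bar>
     \<le> real (cf_denominator \<alpha> n) / real (cf_denominator \<alpha> (Suc n))"
proof -
  let ?q = "real (cf_denominator \<alpha> n)" and ?q' = "real (cf_denominator \<alpha> (Suc n))"
  have pos: "?q > 0" "?q' > 0"
    using cf_denominator_pos[of n] cf_denominator_pos[of "Suc n"] by linarith+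
  have "?q' * \<bar>cf_error n\<bar> \<le> 1"
    using cf_error_balance[of n] mult_nonneg_nonneg[of ?q "\<bar>cf_error (Suc n)\<bar>"] pos by linarith
  then have "\<bar>cf_error n\<bar> \<le> 1 / ?q'" using pos by (simp add: field_simps)
  moreover have "?q\<^sup>2 * \<bar>\<alpha> - real (cf_numerator \<alpha> n) / ?q\<bar> = ?q * \<bar>cf_error n\<bar>"
  proof -
    have "cf_error n = ?q * (\<alpha> - real (cf_numerator \<alpha> n) / ?q)"
      using pos by (simp add: cf_error_def right_diff_distrib)
    then show ?thesis using pos by (simp add: abs_mult power2_eq_square)
  qed
  ultimately show ?thesis
    using mult_left_mono[of "\<bar>cf_error n\<bar>" "1 / ?q'" ?q] by simp
qed

end

section \<open>Near independence of fast square waves\<close>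

lemma norm_iexp_diff_le: "norm (iexp a - iexp b) \<le> \<bar>a - b\<bar>"
proof -
  have "iexp a - iexp b = iexp b * (iexp (a - b) - 1)"
    by (simp add: right_diff_distrib flip: exp_add)
  then have "norm (iexp a - iexp b) = norm (iexp (a - b) - 1)"
    by (simp add: norm_mult)
  also have "\<dots> \<le> \<bar>a - b\<bar>" using iexp_approx1[of "a - b" 0] by simp
  finally show ?thesis .
qed

lemma iexp_sign:
  assumes "X = 1 \<or> X = -1"
  shows "iexp (\<theta> * X) = of_real (cos \<theta>) + \<i> * of_real (sin \<theta>) * of_real X"
  using assms by (auto simp: exp_Euler cos_of_real sin_of_real)

text \<open>
  Both functions agree with \<open>1 - \<theta>\<^sup>2/2\<close> up to a multiple of \<open>\<theta>\<^sup>4\<close>.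
\<close>

lemma cos_gauss_diff: "\<bar>cos \<theta> - exp (- (\<theta>\<^sup>2) / 2)\<bar> \<le> \<theta> ^ 4" for \<theta> :: real
proof -
  have "\<bar>cos \<theta> - (1 - \<theta>\<^sup>2 / 2)\<bar> \<le> \<theta> ^ 4 / 24"
  proof -
    have "\<bar>Re (iexp \<theta> - (\<Sum>k\<le>3. (\<i> * \<theta>) ^ k / fact k))\<bar> \<le> \<bar>\<theta>\<bar> ^ Suc 3 / fact (Suc 3)"
      by (rule order_trans[OF abs_Re_le_cmod iexp_approx1])
    moreover have "Re (iexp \<theta> - (\<Sum>k\<le>3. (\<i> * \<theta>) ^ k / fact k)) = cos \<theta> - (1 - \<theta>\<^sup>2 / 2)"
      by (simp add: numeral_3_eq_3 Re_exp power2_eq_square)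
    ultimately show ?thesis by (simp add: fact_numeral)
  qed
  moreover have "\<bar>exp (- y) - (1 - y)\<bar> \<le> y\<^sup>2 / 2" if "0 \<le> y" for y :: real
  proof -
    \<comment> \<open>The Taylor polynomials of degree 2 of \<open>exp (- y)\<close> and \<open>exp y\<close> are almost inverse to each other.\<close>
    have "(1 - y + y\<^sup>2 / 2) * (1 + y + y\<^sup>2 / 2) = 1 + y ^ 4 / 4"
      by (simp add: algebra_simps power2_eq_square power4_eq_xxxx)
    moreover have "y ^ 4 \<ge> 0" by simp
    moreover have "0 \<le> 1 - y + y\<^sup>2 / 2"
      using sum_squares_ge_zero[of "1 - y" 1] by (simp add: power2_eq_square algebra_simps)
    ultimately have "1 \<le> (1 - y + y\<^sup>2 / 2) * exp y"
      using exp_lower_Taylor_quadratic[OF that] mult_left_mono[of "1 + y + y\<^sup>2 / 2" "exp y" "1 - y + y\<^sup>2 / 2"]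
      by linarith
    then have "exp (- y) \<le> 1 - y + y\<^sup>2 / 2"
      by (simp add: exp_minus field_simps)
    moreover have "1 - y \<le> exp (- y)" using exp_ge_add_one_self[of "- y"] by simp
    ultimately show ?thesis by linarith
  qed
  from this[of "\<theta>\<^sup>2 / 2"] have "\<bar>exp (- (\<theta>\<^sup>2) / 2) - (1 - \<theta>\<^sup>2 / 2)\<bar> \<le> \<theta> ^ 4 / 8"
    by (simp add: power_divide flip: power_mult)
  moreover have "\<theta> ^ 4 \<ge> 0" by simp
  ultimately show ?thesis by linarith
qed

lemma integral_square_wave_shift:
  assumes "q > 0"
  shows "(\<integral>x. \<bar>square_wave (real q * (x + \<delta>) + c) - square_wave (real q * x + c)\<bar> \<partial>circle_measure)
    \<le> 4 * real q * \<bar>\<delta>\<bar>"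
proof -
  let ?d = "\<lambda>a b x. \<bar>real_of_int \<lfloor>real q * x + a\<rfloor> - real_of_int \<lfloor>real q * x + b\<rfloor>\<bar>"
  let ?e = "real q * \<delta>"
  note i = integrable_floor_diff
  have pt: "\<bar>square_wave (real q * (x + \<delta>) + c) - square_wave (real q * x + c)\<bar>
      \<le> 2 * ?d (c + ?e) c x + 2 * ?d (c + ?e - 1/2) (c - 1/2) x" for x
  proof -
    have gen: "\<bar>(2 * (a - b) - 1) - (2 * (a' - b') - 1)\<bar> \<le> 2 * \<bar>a - a'\<bar> + 2 * \<bar>b - b'\<bar>"
      for a b a' b' :: real
    proof -
      have "(2 * (a - b) - 1) - (2 * (a' - b') - 1) = 2 * (a - a') - 2 * (b - b')" by simp
      then show ?thesis
        using abs_triangle_ineq4[of "2 * (a - a')" "2 * (b - b')"] by (simp only: abs_mult abs_numeral)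
    qed
    have "real q * (x + \<delta>) + c = real q * x + (c + ?e)"
      "real q * x + (c + ?e) - 1/2 = real q * x + (c + ?e - 1/2)"
      "real q * x + c - 1/2 = real q * x + (c - 1/2)"
      by (simp_all add: distrib_left)
    then show ?thesis
      unfolding square_wave_def by (simp only: gen)
  qed
  have "(\<integral>x. \<bar>square_wave (real q * (x + \<delta>) + c) - square_wave (real q * x + c)\<bar> \<partial>circle_measure)
      \<le> (\<integral>x. 2 * ?d (c + ?e) c x + 2 * ?d (c + ?e - 1/2) (c - 1/2) x \<partial>circle_measure)"
  proof (rule integral_mono)
    have "norm \<bar>square_wave a - square_wave b\<bar> \<le> 2" for a b
      using square_wave_values[of a] square_wave_values[of b] by auto
    then show "integrable circle_measure (\<lambda>x. \<bar>square_wave (real q * (x + \<delta>) + c) - square_wave (real q * x + c)\<bar>)"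
      by (intro integrable_circle_bounded[where B=2]) auto
  qed (intro Bochner_Integration.integrable_add integrable_mult_right i pt)+
  also have "\<dots> = 2 * (\<integral>x. ?d (c + ?e) c x \<partial>circle_measure) + 2 * (\<integral>x. ?d (c + ?e - 1/2) (c - 1/2) x \<partial>circle_measure)"
    by (simp only: Bochner_Integration.integral_add integrable_mult_right i integral_mult_right_zero)
  also have "\<dots> \<le> 4 * \<bar>?e\<bar>"
    using integral_floor_diff_dilated[OF assms, of "c + ?e" c]
      integral_floor_diff_dilated[OF assms, of "c + ?e - 1/2" "c - 1/2"] by simp
  finally show ?thesis by (simp add: abs_mult)
qed

context
  fixes Q :: "nat \<Rightarrow> nat" and c \<theta> :: "nat \<Rightarrow> real"
  assumes Q_pos: "\<And>k. Q k > 0"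
begin

definition wave :: "nat \<Rightarrow> real \<Rightarrow> real" where
  "wave k x = square_wave (real (Q k) * x + c k)"

definition wave_char :: "nat \<Rightarrow> real \<Rightarrow> complex" where
  "wave_char m x = iexp (\<Sum>k = 1..m. \<theta> k * wave k x)"

lemma measurable_wave [measurable]: "wave k \<in> borel_measurable borel"
  unfolding wave_def [abs_def] by measurable

lemma measurable_wave_char [measurable]: "wave_char m \<in> borel_measurable borel"
  unfolding wave_char_def [abs_def] by measurable

lemma wave_values: "wave k x = 1 \<or> wave k x = -1"
  unfolding wave_def by (rule square_wave_values)

lemma abs_wave [simp]: "\<bar>wave k x\<bar> = 1"
  using wave_values[of k x] by auto

lemma wave_periodic: "wave k (x + 1) = wave k x"
  using square_wave_periodic[of "real (Q k) * x + c k" "Q k"] by (simp add: wave_def algebra_simps)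

lemma norm_wave_char [simp]: "norm (wave_char m x) = 1"
  by (simp add: wave_char_def)

lemma wave_char_periodic: "wave_char m (x + 1) = wave_char m x"
  by (simp add: wave_char_def wave_periodic)

lemma wave_antiperiodic: "wave k (x + 1 / (2 * real (Q k))) = - wave k x"
  using Q_pos[of k] square_wave_half_period[of "real (Q k) * x + c k"]
  by (simp add: wave_def distrib_left ac_simps)

text \<open>
  Translation by half a period of the \<open>k\<close>-th wave changes the sign of this wave, so the integral is
  half the correlation of the wave with the increment of \<open>wave_char m\<close>. That increment is at most the
  sum of the increments of the phases, and the \<open>j\<close>-th wave changes only on a set of measure
  proportional to \<open>Q j\<close> times the translation.
\<close>

lemma wave_char_next_correlation:
  "norm (\<integral>x. wave_char m x * of_real (wave k x) \<partial>circle_measure)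
     \<le> (\<Sum>j = 1..m. \<bar>\<theta> j\<bar> * (real (Q j) / real (Q k)))"
proof -
  \<comment> \<open>Half a period of the wave with index \<open>k\<close>.\<close>
  define \<delta> where "\<delta> = 1 / (2 * real (Q k))"
  have "\<delta> \<ge> 0" by (simp add: \<delta>_def)
  let ?F = "wave_char m" and ?X = "\<lambda>x. complex_of_real (wave k x)"
  have i: "integrable circle_measure (\<lambda>x. ?F (x + s) * ?X x)" for s
    by (rule integrable_circle_bounded[where B=1]) (auto simp: norm_mult)
  have i': "integrable circle_measure (\<lambda>x. \<bar>wave j x - wave j (x + \<delta>)\<bar>)" for j
  proof (rule integrable_circle_bounded[where B=2])
    show "norm \<bar>wave j x - wave j (x + \<delta>)\<bar> \<le> 2" for x
      using wave_values[of j x] wave_values[of j "x + \<delta>"] by auto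
  qed measurable
  have "(\<integral>x. ?F x * ?X x \<partial>circle_measure) = (\<integral>x. ?F (x + \<delta>) * ?X (x + \<delta>) \<partial>circle_measure)"
    by (rule integral_circle_shift[where B=1, symmetric]) (auto simp: norm_mult wave_char_periodic wave_periodic)
  also have "\<dots> = - (\<integral>x. ?F (x + \<delta>) * ?X x \<partial>circle_measure)"
    by (simp add: \<delta>_def wave_antiperiodic)
  finally have "2 * (\<integral>x. ?F x * ?X x \<partial>circle_measure) = (\<integral>x. ?F x * ?X x - ?F (x + \<delta>) * ?X x \<partial>circle_measure)"
    using i[of 0] i[of \<delta>] by simp
  then have "2 * norm (\<integral>x. ?F x * ?X x \<partial>circle_measure) = norm (\<integral>x. ?F x * ?X x - ?F (x + \<delta>) * ?X x \<partial>circle_measure)"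
    by (metis norm_mult norm_numeral)
  also have "\<dots> \<le> (\<integral>x. (\<Sum>j = 1..m. \<bar>\<theta> j\<bar> * \<bar>wave j x - wave j (x + \<delta>)\<bar>) \<partial>circle_measure)"
  proof (rule order_trans[OF integral_norm_bound integral_mono])
    show "integrable circle_measure (\<lambda>x. norm (?F x * ?X x - ?F (x + \<delta>) * ?X x))"
      using i[of 0] i[of \<delta>] by (intro integrable_norm Bochner_Integration.integrable_diff) auto
    show "integrable circle_measure (\<lambda>x. \<Sum>j = 1..m. \<bar>\<theta> j\<bar> * \<bar>wave j x - wave j (x + \<delta>)\<bar>)"
      by (intro Bochner_Integration.integrable_sum integrable_mult_right i')
    fix x
    have "norm (?F x * ?X x - ?F (x + \<delta>) * ?X x) = norm (?F x - ?F (x + \<delta>))"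
      by (simp add: norm_mult flip: left_diff_distrib)
    also have "\<dots> \<le> \<bar>(\<Sum>j = 1..m. \<theta> j * wave j x) - (\<Sum>j = 1..m. \<theta> j * wave j (x + \<delta>))\<bar>"
      unfolding wave_char_def by (rule norm_iexp_diff_le)
    also have "\<dots> \<le> (\<Sum>j = 1..m. \<bar>\<theta> j * wave j x - \<theta> j * wave j (x + \<delta>)\<bar>)"
      unfolding sum_subtractf [symmetric] by (rule sum_abs)
    also have "\<dots> = (\<Sum>j = 1..m. \<bar>\<theta> j\<bar> * \<bar>wave j x - wave j (x + \<delta>)\<bar>)"
      by (simp add: abs_mult flip: right_diff_distrib)
    finally show "norm (?F x * ?X x - ?F (x + \<delta>) * ?X x) \<le> (\<Sum>j = 1..m. \<bar>\<theta> j\<bar> * \<bar>wave j x - wave j (x + \<delta>)\<bar>)" .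
  qed
  also have "\<dots> = (\<Sum>j = 1..m. \<bar>\<theta> j\<bar> * (\<integral>x. \<bar>wave j x - wave j (x + \<delta>)\<bar> \<partial>circle_measure))"
    using i' by (simp del: space_circle_measure)
  also have "\<dots> \<le> (\<Sum>j = 1..m. \<bar>\<theta> j\<bar> * (4 * real (Q j) * \<delta>))"
    using integral_square_wave_shift[OF Q_pos, of _ \<delta>] \<open>\<delta> \<ge> 0\<close>
    by (intro sum_mono mult_left_mono) (auto simp: wave_def abs_minus_commute)
  also have "\<dots> = 2 * (\<Sum>j = 1..m. \<bar>\<theta> j\<bar> * (real (Q j) / real (Q k)))"
    unfolding sum_distrib_left by (intro sum.cong refl) (simp add: \<delta>_def)
  finally show ?thesis by simp
qed

text \<open>
  A sign \<open>X\<close> satisfies \<open>exp (i \<theta> X) = cos \<theta> + i X sin \<theta>\<close>. The cosine gives the Gaussian factor, and the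
  sine multiplies a correlation that is already small; the extra factor \<open>\<bar>\<theta>\<bar>\<close> is what makes the
  accumulated error vanish.
\<close>

lemma wave_char_step:
  "norm ((\<integral>x. wave_char (Suc m) x \<partial>circle_measure)
       - of_real (exp (- ((\<theta> (Suc m))\<^sup>2) / 2)) * (\<integral>x. wave_char m x \<partial>circle_measure))
     \<le> \<bar>\<theta> (Suc m)\<bar> * (\<Sum>j = 1..m. \<bar>\<theta> j\<bar> * (real (Q j) / real (Q (Suc m)))) + \<theta> (Suc m) ^ 4"
proof -
  let ?t = "\<theta> (Suc m)" and ?X = "\<lambda>x. complex_of_real (wave (Suc m) x)"
  let ?I = "\<integral>x. wave_char m x \<partial>circle_measure" and ?J = "\<integral>x. wave_char m x * ?X x \<partial>circle_measure"
  have i: "integrable circle_measure (wave_char m)"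
    by (rule integrable_circle_bounded[where B=1]) auto
  have j: "integrable circle_measure (\<lambda>x. wave_char m x * ?X x)"
    by (rule integrable_circle_bounded[where B=1]) (auto simp: norm_mult)
  have "wave_char (Suc m) x = of_real (cos ?t) * wave_char m x + (\<i> * of_real (sin ?t)) * (wave_char m x * ?X x)" for x
  proof -
    have split: "(\<Sum>k = 1..Suc m. \<theta> k * wave k x) = (\<Sum>k = 1..m. \<theta> k * wave k x) + ?t * wave (Suc m) x"
      by simp
    have "wave_char (Suc m) x = wave_char m x * iexp (?t * wave (Suc m) x)"
      unfolding wave_char_def split of_real_add distrib_left exp_add ..
    also have "\<dots> = wave_char m x * (of_real (cos ?t) + \<i> * of_real (sin ?t) * ?X x)"
      by (rule arg_cong[OF iexp_sign[OF wave_values]])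
    finally show ?thesis by (simp only: distrib_left mult_ac)
  qed
  then have "(\<integral>x. wave_char (Suc m) x \<partial>circle_measure) = of_real (cos ?t) * ?I + (\<i> * of_real (sin ?t)) * ?J"
    by (simp only: Bochner_Integration.integral_add[OF integrable_mult_right[OF i] integrable_mult_right[OF j]]
        integral_mult_right_zero)
  then have eq: "(\<integral>x. wave_char (Suc m) x \<partial>circle_measure) - of_real (exp (- (?t\<^sup>2) / 2)) * ?I
      = of_real (cos ?t - exp (- (?t\<^sup>2) / 2)) * ?I + (\<i> * of_real (sin ?t)) * ?J"
    by (simp only: of_real_diff left_diff_distrib add_diff_eq diff_add_eq)
  have "norm ((\<integral>x. wave_char (Suc m) x \<partial>circle_measure) - of_real (exp (- (?t\<^sup>2) / 2)) * ?I)
      \<le> \<bar>cos ?t - exp (- (?t\<^sup>2) / 2)\<bar> * norm ?I + \<bar>sin ?t\<bar> * norm ?J"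
    unfolding eq by (rule norm_triangle_le) (simp only: norm_mult norm_of_real norm_ii mult_1 order.refl)
  also have "\<dots> \<le> ?t ^ 4 * 1 + \<bar>?t\<bar> * norm ?J"
  proof (rule add_mono)
    have "norm ?I \<le> (\<integral>x. norm (wave_char m x) \<partial>circle_measure)" by (rule integral_norm_bound)
    also have "\<dots> = 1" by (simp add: circle.prob_space del: space_circle_measure)
    finally show "\<bar>cos ?t - exp (- (?t\<^sup>2) / 2)\<bar> * norm ?I \<le> ?t ^ 4 * 1"
      by (rule mult_mono[OF cos_gauss_diff]) simp_all
    show "\<bar>sin ?t\<bar> * norm ?J \<le> \<bar>?t\<bar> * norm ?J"
      by (rule mult_right_mono[OF abs_sin_x_le_abs_x norm_ge_zero])
  qed
  also have "\<dots> \<le> ?t ^ 4 * 1 + \<bar>?t\<bar> * (\<Sum>j = 1..m. \<bar>\<theta> j\<bar> * (real (Q j) / real (Q (Suc m))))"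
    by (rule add_left_mono[OF mult_left_mono[OF wave_char_next_correlation abs_ge_zero]])
  finally show ?thesis by (simp only: add.commute mult_1_right)
qed

lemma wave_char_gaussian:
  "norm ((\<integral>x. wave_char m x \<partial>circle_measure) - of_real (exp (- (\<Sum>k = 1..m. (\<theta> k)\<^sup>2) / 2)))
     \<le> (\<Sum>k = 1..m. \<bar>\<theta> k\<bar> * (\<Sum>j = 1..<k. \<bar>\<theta> j\<bar> * (real (Q j) / real (Q k))) + \<theta> k ^ 4)"
proof -
  define I where "I m = (\<integral>x. wave_char m x \<partial>circle_measure)" for m
  define E where "E m = complex_of_real (exp (- (\<Sum>k = 1..m. (\<theta> k)\<^sup>2) / 2))" for m
  define g where "g m = complex_of_real (exp (- ((\<theta> m)\<^sup>2) / 2))" for m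
  define e where "e k = \<bar>\<theta> k\<bar> * (\<Sum>j = 1..<k. \<bar>\<theta> j\<bar> * (real (Q j) / real (Q k))) + \<theta> k ^ 4" for k
  have step: "norm (I (Suc m) - g (Suc m) * I m) \<le> e (Suc m)" for m
    unfolding I_def g_def e_def atLeastLessThanSuc_atLeastAtMost by (rule wave_char_step)
  have split: "sum f {1..Suc m} = f (Suc m) + sum f {1..m}" for f :: "nat \<Rightarrow> real" and m
    by (simp add: add.commute)
  have E_Suc: "E (Suc m) = g (Suc m) * E m" for m
    unfolding E_def g_def split minus_add_distrib add_divide_distrib exp_add of_real_mult
    by (simp add: diff_divide_distrib exp_diff exp_minus field_simps)
  have "norm (I m - E m) \<le> (\<Sum>k = 1..m. e k)"
  proof (induction m)
    case 0
    have "wave_char 0 = (\<lambda>_. 1)" by (simp add: fun_eq_iff wave_char_def)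
    then show ?case by (simp add: I_def E_def circle.prob_space del: space_circle_measure)
  next
    case (Suc m)
    have "norm (I (Suc m) - E (Suc m)) = norm ((I (Suc m) - g (Suc m) * I m) + g (Suc m) * (I m - E m))"
      by (simp add: E_Suc right_diff_distrib)
    also have "\<dots> \<le> norm (I (Suc m) - g (Suc m) * I m) + norm (g (Suc m)) * norm (I m - E m)"
      by (rule norm_triangle_le) (simp add: norm_mult)
    also have "\<dots> \<le> e (Suc m) + 1 * (\<Sum>k = 1..m. e k)"
      by (intro add_mono mult_mono Suc step) (simp_all add: g_def)
    finally show ?case unfolding split by simp
  qed
  then show ?thesis by (simp only: I_def E_def e_def)
qed

end

section \<open>The central limit theorem\<close>

text \<open>
  From index \<open>2\<close> on, consecutive terms cancel in the deviation from the mean, so the partial sums stay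
  within bounded distance of \<open>N (a + b) / 2\<close>.
\<close>

lemma alternating_average:
  fixes s :: "nat \<Rightarrow> real"
  assumes "\<And>k. k \<ge> 1 \<Longrightarrow> s (2 * k) = b" "\<And>k. k \<ge> 1 \<Longrightarrow> s (2 * k + 1) = a"
  shows "(\<lambda>N. (\<Sum>k = 1..N. s k) / real N) \<longlonglongrightarrow> (a + b) / 2"
proof -
  have sum: "(\<Sum>k = 1..Suc n. s k) = s 1 + real n * (a + b) / 2 + (if odd n then (b - a) / 2 else 0)" for n
  proof (induction n)
    case (Suc n)
    show ?case
    proof (cases "odd n")
      case True
      then obtain k where "n = 2 * k + 1" by (elim oddE)
      then have "s (Suc (Suc n)) = a" using assms(2)[of "Suc k"] by simp
      with Suc True show ?thesis by (simp add: field_simps)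
    next
      case False
      then obtain k where "n = 2 * k" by (auto elim: evenE)
      then have "s (Suc (Suc n)) = b" using assms(1)[of "Suc k"] by simp
      with Suc False show ?thesis by (simp add: field_simps)
    qed
  qed simp
  define C where "C = \<bar>s 1\<bar> + \<bar>a + b\<bar> + \<bar>b - a\<bar>"
  have "\<bar>(\<Sum>k = 1..N. s k) / real N - (a + b) / 2\<bar> \<le> C / real N" if N: "N \<ge> 1" for N
  proof -
    obtain n where n: "N = Suc n" using N by (cases N) auto
    have "(\<Sum>k = 1..N. s k) - real N * ((a + b) / 2) = s 1 - (a + b) / 2 + (if odd n then (b - a) / 2 else 0)"
      unfolding n sum by (simp add: field_simps)
    also have "\<bar>\<dots>\<bar> \<le> C" by (auto simp: C_def abs_if field_simps)
    finally have "\<bar>(\<Sum>k = 1..N. s k) - real N * ((a + b) / 2)\<bar> / real N \<le> C / real N"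
      by (rule divide_right_mono) simp
    moreover have "(\<Sum>k = 1..N. s k) / real N - (a + b) / 2 = ((\<Sum>k = 1..N. s k) - real N * ((a + b) / 2)) / real N"
      using N by (simp add: field_simps)
    ultimately show ?thesis by (simp only: abs_divide abs_of_nat)
  qed
  then have "\<forall>\<^sub>F N in sequentially. norm ((\<Sum>k = 1..N. s k) / real N - (a + b) / 2) \<le> C / real N"
    by (auto simp: eventually_sequentially)
  then have "(\<lambda>N. (\<Sum>k = 1..N. s k) / real N - (a + b) / 2) \<longlonglongrightarrow> 0"
    by (rule Lim_null_comparison) (rule lim_const_over_n)
  then show ?thesis by (simp add: LIM_zero_iff)
qed

lemma rotation_sum_add:
  "rotation_sum \<alpha> f (m + n) x = rotation_sum \<alpha> f m x + rotation_sum \<alpha> f n (x + real m * \<alpha>)"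
  by (induction n) (simp_all add: rotation_sum_def algebra_simps)

lemma rotation_sum_blocks:
  fixes q :: "nat \<Rightarrow> nat"
  shows "rotation_sum \<alpha> f (\<Sum>k = 1..N. q k) x =
     (\<Sum>k = 1..N. rotation_sum \<alpha> f (q k) (x + real (\<Sum>j = 1..<k. q j) * \<alpha>))"
proof (induction N)
  case 0
  show ?case by (simp add: rotation_sum_def)
next
  case (Suc N)
  have "(\<Sum>k = 1..Suc N. q k) = (\<Sum>k = 1..N. q k) + q (Suc N)" by simp
  then show ?case
    using Suc by (simp only: rotation_sum_add) (simp add: atLeastLessThanSuc_atLeastAtMost)
qed

lemma inner_rotation_sum_psi:
  "u \<bullet> rotation_sum \<alpha> (psi \<alpha>) n x = u $ 1 * rotation_sum \<alpha> (phi1 \<alpha>) n x + u $ 2 * rotation_sum \<alpha> (phi2 \<alpha>) n x"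
  by (simp add: rotation_sum_def psi_def inner_sum_right inner_vector2 sum.distrib sum_distrib_left)

lemma measurable_rotation_sum_psi [measurable]: "rotation_sum \<alpha> (psi \<alpha>) n \<in> borel_measurable borel"
  unfolding rotation_sum_def [abs_def] psi_def phi1_eq phi2_eq by measurable

lemma measurable_rotation_sum [measurable]:
  fixes f :: "real \<Rightarrow> real"
  assumes [measurable]: "f \<in> borel_measurable borel"
  shows "rotation_sum \<alpha> f n \<in> borel_measurable borel"
  unfolding rotation_sum_def [abs_def] by measurable

lemma integrable_rotation_sum_error:
  assumes f: "f \<in> borel_measurable borel" "\<And>x. \<bar>f x\<bar> \<le> 1"
  shows "integrable circle_measure (\<lambda>x. rotation_sum \<alpha> f q (x + s) - (if P then square_wave (real q * (x + s)) else 0))"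
proof (rule integrable_circle_bounded[where B="real q + 1"])
  show "(\<lambda>x. rotation_sum \<alpha> f q (x + s) - (if P then square_wave (real q * (x + s)) else 0)) \<in> borel_measurable borel"
    using f(1) by measurable
  show "norm (rotation_sum \<alpha> f q (x + s) - (if P then square_wave (real q * (x + s)) else 0)) \<le> real q + 1" for x
  proof -
    have "\<bar>rotation_sum \<alpha> f q (x + s)\<bar> \<le> (\<Sum>j<q. 1)"
      unfolding rotation_sum_def by (rule order_trans[OF sum_abs sum_mono]) (rule f(2))
    then have "\<bar>rotation_sum \<alpha> f q (x + s)\<bar> \<le> real q" by simp
    then show ?thesis using square_wave_values[of "real q * (x + s)"] by auto
  qed
qed

lemma sum_powr_le_suminf:
  fixes \<beta> :: real
  assumes "\<beta> > 1"
  shows "(\<Sum>k = 1..N. real k powr (- \<beta>)) \<le> (\<Sum>n. real n powr (- \<beta>))"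
    and "(\<Sum>k = 1..N. real (k - 1) powr (- \<beta>)) \<le> (\<Sum>n. real n powr (- \<beta>))"
proof -
  have s: "summable (\<lambda>n. real n powr (- \<beta>))" using assms by (simp add: summable_real_powr_iff)
  show "(\<Sum>k = 1..N. real k powr (- \<beta>)) \<le> (\<Sum>n. real n powr (- \<beta>))"
    by (rule sum_le_suminf[OF s]) auto
  have "(\<Sum>k = 1..N. real (k - 1) powr (- \<beta>)) = (\<Sum>n<N. real n powr (- \<beta>))"
    by (rule sum.reindex_bij_witness[where i=Suc and j="\<lambda>k. k - 1"]) auto
  also have "\<dots> \<le> (\<Sum>n. real n powr (- \<beta>))"
    by (rule sum_le_suminf[OF s]) auto
  finally show "(\<Sum>k = 1..N. real (k - 1) powr (- \<beta>)) \<le> (\<Sum>n. real n powr (- \<beta>))" .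
qed

lemma scaled_square: "real N powr (- 1/2) * real N powr (- 1/2) = 1 / real N" if "N \<ge> 1"
  using that by (simp add: powr_minus_divide flip: powr_add)

text \<open>
  The error in \<open>wave_char_gaussian\<close> is quadratic in the \<open>\<theta>\<^sub>k\<close>, hence at most \<open>1/N\<close> times a constant
  multiple of the convergent sum of the gap ratios, plus the quartic terms, which also add up to
  \<open>O(1/N)\<close>.
\<close>

lemma wave_char_tendsto:
  fixes Q :: "nat \<Rightarrow> nat" and c v :: "nat \<Rightarrow> real"
  assumes Q_pos: "\<And>k. Q k > 0" and "\<beta> > 1"
    and gap: "\<And>k. k \<ge> 1 \<Longrightarrow> (\<Sum>j = 1..<k. real (Q j) / real (Q k)) \<le> 4 * real (k - 1) powr (- \<beta>)"
    and v: "\<And>k. \<bar>v k\<bar> \<le> U"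
    and avg: "(\<lambda>N. (\<Sum>k = 1..N. (v k)\<^sup>2) / real N) \<longlonglongrightarrow> \<sigma>"
  shows "(\<lambda>N. \<integral>x. wave_char Q c (\<lambda>k. real N powr (- 1/2) * v k) N x \<partial>circle_measure)
    \<longlonglongrightarrow> of_real (exp (- \<sigma> / 2))"
proof -
  define r where "r N = real N powr (- 1/2)" for N
  define Z where "Z = (\<Sum>n. real n powr (- \<beta>))"
  define E where "E N = complex_of_real (exp (- (\<Sum>k = 1..N. (r N * v k)\<^sup>2) / 2))" for N
  let ?I = "\<lambda>N. \<integral>x. wave_char Q c (\<lambda>k. r N * v k) N x \<partial>circle_measure"
  have r: "r N \<ge> 0" for N by (simp add: r_def)
  have "U \<ge> 0" using v[of 0] by linarith
  have bound: "norm (?I N - E N) \<le> (4 * U\<^sup>2 * Z + U ^ 4) / real N" if N: "N \<ge> 1" for N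
  proof -
    have rr: "r N * r N = 1 / real N" unfolding r_def by (rule scaled_square[OF N])
    have rv: "\<bar>r N * v k\<bar> \<le> r N * U" for k
      using mult_left_mono[OF v[of k] r[of N]] r[of N] by (simp add: abs_mult)
    have "norm (?I N - E N) \<le> (\<Sum>k = 1..N. \<bar>r N * v k\<bar> * (\<Sum>j = 1..<k. \<bar>r N * v j\<bar> * (real (Q j) / real (Q k))) + (r N * v k) ^ 4)"
      unfolding E_def by (rule wave_char_gaussian[OF Q_pos])
    also have "\<dots> \<le> (\<Sum>k = 1..N. 4 * U\<^sup>2 / real N * real (k - 1) powr (- \<beta>) + U ^ 4 / (real N * real N))"
    proof (rule sum_mono, rule add_mono)
      fix k assume k: "k \<in> {1..N}"
      have "(\<Sum>j = 1..<k. \<bar>r N * v j\<bar> * (real (Q j) / real (Q k))) \<le> (\<Sum>j = 1..<k. (r N * U) * (real (Q j) / real (Q k)))"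
        by (intro sum_mono mult_right_mono rv) simp
      also have "\<dots> = (r N * U) * (\<Sum>j = 1..<k. real (Q j) / real (Q k))"
        by (simp only: sum_distrib_left)
      also have "\<dots> \<le> (r N * U) * (4 * real (k - 1) powr (- \<beta>))"
        using k r \<open>U \<ge> 0\<close> by (intro mult_left_mono gap) auto
      finally have "\<bar>r N * v k\<bar> * (\<Sum>j = 1..<k. \<bar>r N * v j\<bar> * (real (Q j) / real (Q k)))
          \<le> (r N * U) * ((r N * U) * (4 * real (k - 1) powr (- \<beta>)))"
        using r[of N] \<open>U \<ge> 0\<close> by (intro mult_mono rv) (auto intro!: sum_nonneg)
      moreover have "(r N * U) * ((r N * U) * (4 * real (k - 1) powr (- \<beta>)))
          = 4 * U\<^sup>2 * (r N * r N) * real (k - 1) powr (- \<beta>)" by (simp add: power2_eq_square)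
      ultimately show "\<bar>r N * v k\<bar> * (\<Sum>j = 1..<k. \<bar>r N * v j\<bar> * (real (Q j) / real (Q k)))
          \<le> 4 * U\<^sup>2 / real N * real (k - 1) powr (- \<beta>)" by (simp add: rr)
      have "(r N * v k) ^ 4 = \<bar>r N * v k\<bar> ^ 4" by simp
      also have "\<dots> \<le> (r N * U) ^ 4" by (rule power_mono[OF rv]) simp
      also have "\<dots> = U ^ 4 * ((r N * r N) * (r N * r N))" by (simp add: power4_eq_xxxx)
      finally show "(r N * v k) ^ 4 \<le> U ^ 4 / (real N * real N)" by (simp add: rr)
    qed
    also have "\<dots> = 4 * U\<^sup>2 / real N * (\<Sum>k = 1..N. real (k - 1) powr (- \<beta>)) + U ^ 4 / real N"
      using N by (simp add: sum.distrib sum_distrib_left)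
    also have "\<dots> \<le> 4 * U\<^sup>2 / real N * Z + U ^ 4 / real N"
      unfolding Z_def by (intro add_right_mono mult_left_mono sum_powr_le_suminf(2)[OF \<open>\<beta> > 1\<close>]) simp
    finally show ?thesis by (simp add: add_divide_distrib)
  qed
  have "(\<lambda>N. ?I N - E N) \<longlonglongrightarrow> 0"
  proof (rule Lim_null_comparison)
    show "\<forall>\<^sub>F N in sequentially. norm (?I N - E N) \<le> (4 * U\<^sup>2 * Z + U ^ 4) / real N"
      using eventually_ge_at_top[of 1] by eventually_elim (rule bound)
  qed (rule lim_const_over_n)
  moreover have "E \<longlonglongrightarrow> of_real (exp (- \<sigma> / 2))"
  proof -
    have "(\<lambda>N. complex_of_real (exp (- ((\<Sum>k = 1..N. (v k)\<^sup>2) / real N) / 2))) \<longlonglongrightarrow> of_real (exp (- \<sigma> / 2))"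
      by (intro tendsto_intros avg) simp
    moreover have "\<forall>\<^sub>F N in sequentially. complex_of_real (exp (- ((\<Sum>k = 1..N. (v k)\<^sup>2) / real N) / 2)) = E N"
      using eventually_ge_at_top[of 1]
    proof eventually_elim
      case (elim N)
      have "(r N * v k)\<^sup>2 = (v k)\<^sup>2 / real N" for k
        using scaled_square[OF elim] by (simp add: power2_eq_square r_def ac_simps flip: mult.assoc)
      then show ?case by (simp add: E_def sum_divide_distrib)
    qed
    ultimately show ?thesis by (rule Lim_transform_eventually)
  qed
  ultimately have "(\<lambda>N. ?I N - E N + E N) \<longlonglongrightarrow> 0 + of_real (exp (- \<sigma> / 2))"
    by (rule tendsto_add)
  then show ?thesis by (simp add: r_def)
qed

text \<open>
  The frequencies \<open>Q k\<close> are the denominators \<open>q\<^bsub>t\<^sub>k\<^esub>\<close>, and \<open>s k\<close> is the rotation accumulated before the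
  \<open>k\<close>-th block. A large partial quotient \<open>a\<^bsub>t\<^sub>k+1\<^esub>\<close> serves twice: it makes \<open>p/q\<close> a good approximation
  in the \<open>k\<close>-th block (\<open>ratio\<close>), and it separates \<open>Q k\<close> from \<open>Q (k + 1)\<close> (\<open>gap\<close>).
\<close>

theorem theorem2p5:
  fixes \<alpha> \<beta> :: real and t :: "nat \<Rightarrow> nat"
  assumes "0 < \<alpha>" and "\<alpha> < 1" and "\<alpha> \<notin> \<rat>"
    and "\<beta> > 1"
    and "strict_mono_on {1..} t"
    and "\<And>k. k \<ge> 1 \<Longrightarrow> t k \<ge> 1"
    and "\<And>k. k \<ge> 1 \<Longrightarrow> odd (cf_denominator \<alpha> (t k))"
    and "\<And>k. k \<ge> 1 \<Longrightarrow> even (cf_numerator \<alpha> (t (2 * k)))"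
    and "\<And>k. k \<ge> 1 \<Longrightarrow> odd (cf_numerator \<alpha> (t (2 * k + 1)))"
    and "\<And>k. k \<ge> 1 \<Longrightarrow> real (cf_quotient \<alpha> (t k + 1)) \<ge> real k powr \<beta>"
  defines "L \<equiv> \<lambda>N::nat. \<Sum>k = 1..N. cf_denominator \<alpha> (t k)"
  shows "converges_in_distribution circle_measure
           (\<lambda>N x. (real N powr (- 1/2)) *\<^sub>R rotation_sum \<alpha> (psi \<alpha>) (L N) x)
           (centered_gaussian (vector [vector [1/2, 0], vector [0, 1/2]] :: real ^ 2 ^ 2))"
proof -
  note irr = assms(1-3)
  define Q where "Q k = cf_denominator \<alpha> (t k)" for k
  define P where "P k = cf_numerator \<alpha> (t k)" for k
  define s where "s k = real (\<Sum>j = 1..<k. Q j) * \<alpha>" for k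
  define c where "c k = real (Q k) * s k" for k
  define r where "r N = real N powr (- 1/2)" for N
  define S where "S N x = r N *\<^sub>R rotation_sum \<alpha> (psi \<alpha>) (L N) x" for N x
  define Z where "Z = (\<Sum>n. real n powr (- \<beta>))"
  have t_less: "t k < t (Suc k)" if "k \<ge> 1" for k
    using assms(5) that by (auto simp: strict_mono_on_def)
  have Q_pos: "Q k > 0" for k
    using cf_denominator_pos[OF irr, of "t k"] by (simp add: Q_def)
  have Q_mono: "Q k \<le> Q (Suc k)" if "k \<ge> 1" for k
    unfolding Q_def using t_less[OF that] by (intro cf_denominator_mono[OF irr]) simp
  have Q_double: "2 * Q k \<le> Q (Suc (Suc k))" if "k \<ge> 1" for k
  proof -
    have "2 * Q k \<le> cf_denominator \<alpha> (Suc (Suc (t k)))"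
      unfolding Q_def by (rule cf_denominator_double[OF irr])
    also have "\<dots> \<le> Q (Suc (Suc k))"
      unfolding Q_def using t_less[OF that] t_less[of "Suc k"] by (intro cf_denominator_mono[OF irr]) simp
    finally show ?thesis .
  qed
  have Q_sum: "(\<Sum>j = 1..k. Q j) \<le> 4 * Q k" for k
  proof (induction k rule: induct_nat_012)
    case (ge2 k)
    then show ?case
      using Q_mono[of "Suc k"] Q_double[of k] by (cases "k = 0") auto
  qed auto
  have ratio: "real (Q k) / real (cf_denominator \<alpha> (Suc (t k))) \<le> real k powr (- \<beta>)" if "k \<ge> 1" for k
  proof -
    have "real k powr \<beta> * real (Q k) \<le> real (cf_quotient \<alpha> (Suc (t k))) * real (Q k)"
      using assms(10)[OF that] by (intro mult_right_mono) auto
    also have "\<dots> \<le> real (cf_denominator \<alpha> (Suc (t k)))"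
      using cf_denominator_quotient_le[OF irr, of "t k"] unfolding Q_def
      by (simp only: of_nat_le_iff flip: of_nat_mult)
    finally show ?thesis
      using that cf_denominator_pos[OF irr, of "Suc (t k)"]
      by (simp add: powr_minus field_simps del: cf_denominator.simps)
  qed
  have gap: "(\<Sum>j = 1..<k. real (Q j) / real (Q k)) \<le> 4 * real (k - 1) powr (- \<beta>)" if k: "k \<ge> 1" for k
  proof (cases "k = 1")
    case False
    then obtain i where i: "k = Suc i" "i \<ge> 1" using k by (cases k) auto
    have "(\<Sum>j = 1..<k. real (Q j) / real (Q k)) = real (\<Sum>j = 1..i. Q j) / real (Q k)"
      by (simp add: i sum_divide_distrib atLeastLessThanSuc_atLeastAtMost)
    also have "\<dots> \<le> real (4 * Q i) / real (Q k)"
      by (intro divide_right_mono) (simp_all only: of_nat_le_iff Q_sum of_nat_0_le_iff)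
    also have "\<dots> = 4 * (real (Q i) / real (Q k))" by simp
    also have "\<dots> \<le> 4 * (real (Q i) / real (cf_denominator \<alpha> (Suc (t i))))"
    proof -
      have "cf_denominator \<alpha> (Suc (t i)) \<le> Q k"
        unfolding Q_def i using t_less[OF i(2)] by (intro cf_denominator_mono[OF irr]) simp
      then show ?thesis
        using cf_denominator_pos[OF irr, of "Suc (t i)"]
        by (intro mult_left_mono divide_left_mono mult_pos_pos) (simp_all del: cf_denominator.simps)
    qed
    also have "\<dots> \<le> 4 * real i powr (- \<beta>)" using ratio[OF i(2)] by simp
    finally show ?thesis by (simp add: i)
  qed simp
  have S_meas: "S N \<in> borel_measurable circle_measure" for N
    unfolding S_def [abs_def] by (rule measurable_circle_measureI) measurable
  have char: "(\<lambda>N. \<integral>x. iexp (u \<bullet> S N x) \<partial>circle_measure)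
      \<longlonglongrightarrow> of_real (exp (- ((u $ 1)\<^sup>2 + (u $ 2)\<^sup>2) / 4))" for u :: "real ^ 2"
  proof -
    define U where "U = \<bar>u $ 1\<bar> + \<bar>u $ 2\<bar>"
    \<comment> \<open>The parity of the numerator decides in which coordinate the wave of the \<open>k\<close>-th block appears.\<close>
    define v where "v k = (if odd (P k) then u $ 1 else u $ 2)" for k
    define D1 where "D1 k x = rotation_sum \<alpha> (phi1 \<alpha>) (Q k) (x + s k)
        - (if odd (P k) then square_wave (real (Q k) * (x + s k)) else 0)" for k x
    define D2 where "D2 k x = rotation_sum \<alpha> (phi2 \<alpha>) (Q k) (x + s k)
        - (if even (P k) then square_wave (real (Q k) * (x + s k)) else 0)" for k x
    define W where "W N x = wave_char Q c (\<lambda>k. r N * v k) N x" for N x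
    have D_int: "integrable circle_measure (D1 k)" "integrable circle_measure (D2 k)" for k
      unfolding D1_def [abs_def] D2_def [abs_def] phi1_eq phi2_eq
      by (intro integrable_rotation_sum_error measurable_arc_difference arc_difference_bounded)+
    have D_bound: "(\<integral>x. \<bar>D1 k x\<bar> \<partial>circle_measure) \<le> 4 * real k powr (- \<beta>)"
      "(\<integral>x. \<bar>D2 k x\<bar> \<partial>circle_measure) \<le> 4 * real k powr (- \<beta>)" if "k \<ge> 1" for k
    proof -
      have "(real (Q k))\<^sup>2 * \<bar>\<alpha> - real (P k) / real (Q k)\<bar> \<le> real k powr (- \<beta>)"
        using order_trans[OF cf_approximation[OF irr] ratio[OF that, unfolded Q_def]]
        by (simp only: Q_def P_def)
      moreover have "coprime (P k) (Q k)" unfolding P_def Q_def by (rule cf_coprime[OF irr])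
      moreover have "odd (Q k)" unfolding Q_def by (rule assms(7)[OF that])
      ultimately show "(\<integral>x. \<bar>D1 k x\<bar> \<partial>circle_measure) \<le> 4 * real k powr (- \<beta>)"
        "(\<integral>x. \<bar>D2 k x\<bar> \<partial>circle_measure) \<le> 4 * real k powr (- \<beta>)"
        using rotation_sum_phi1[OF irr(1,2), of "Q k" "P k" "s k"] rotation_sum_phi2[OF irr(1,2), of "Q k" "P k" "s k"]
        unfolding D1_def D2_def by linarith+
    qed
    have inner: "u \<bullet> S N x - (\<Sum>k = 1..N. r N * v k * wave Q c k x) = r N * (\<Sum>k = 1..N. u $ 1 * D1 k x + u $ 2 * D2 k x)" for N x
    proof -
      have "u \<bullet> S N x = r N * (\<Sum>k = 1..N. u $ 1 * rotation_sum \<alpha> (phi1 \<alpha>) (Q k) (x + s k)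
          + u $ 2 * rotation_sum \<alpha> (phi2 \<alpha>) (Q k) (x + s k))"
        unfolding S_def L_def Q_def [symmetric] rotation_sum_blocks s_def [symmetric]
        by (simp only: inner_scaleR_right inner_sum_right inner_rotation_sum_psi)
      moreover have "(\<Sum>k = 1..N. r N * v k * wave Q c k x) = r N * (\<Sum>k = 1..N. v k * wave Q c k x)"
        by (simp only: sum_distrib_left mult.assoc)
      moreover have "u $ 1 * rotation_sum \<alpha> (phi1 \<alpha>) (Q k) (x + s k) + u $ 2 * rotation_sum \<alpha> (phi2 \<alpha>) (Q k) (x + s k)
          - v k * wave Q c k x = u $ 1 * D1 k x + u $ 2 * D2 k x" for k
        by (simp add: D1_def D2_def v_def wave_def[OF Q_pos] c_def algebra_simps)
      ultimately show ?thesis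
        by (simp only: right_diff_distrib [symmetric] sum_subtractf [symmetric])
    qed
    have close: "norm ((\<integral>x. iexp (u \<bullet> S N x) \<partial>circle_measure) - (\<integral>x. W N x \<partial>circle_measure)) \<le> 4 * U * Z * r N" for N
    proof -
      let ?B = "\<lambda>x. r N * (\<Sum>k = 1..N. \<bar>u $ 1\<bar> * \<bar>D1 k x\<bar> + \<bar>u $ 2\<bar> * \<bar>D2 k x\<bar>)"
      have "r N \<ge> 0" by (simp add: r_def)
      have i: "integrable circle_measure (\<lambda>x. iexp (u \<bullet> S N x))" "integrable circle_measure (W N)"
      proof -
        show "integrable circle_measure (\<lambda>x. iexp (u \<bullet> S N x))"
          using S_meas[of N] by (intro circle.integrable_const_bound[where B=1]) auto
        show "integrable circle_measure (W N)"
          unfolding W_def [abs_def]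
          by (rule integrable_circle_bounded[where B=1]) (auto simp: norm_wave_char[OF Q_pos] measurable_wave_char[OF Q_pos])
      qed
      have "norm ((\<integral>x. iexp (u \<bullet> S N x) \<partial>circle_measure) - (\<integral>x. W N x \<partial>circle_measure))
          = norm (\<integral>x. iexp (u \<bullet> S N x) - W N x \<partial>circle_measure)"
        using i by simp
      also have "\<dots> \<le> (\<integral>x. norm (iexp (u \<bullet> S N x) - W N x) \<partial>circle_measure)"
        by (rule integral_norm_bound)
      also have "\<dots> \<le> (\<integral>x. ?B x \<partial>circle_measure)"
      proof (rule integral_mono)
        show "integrable circle_measure (\<lambda>x. norm (iexp (u \<bullet> S N x) - W N x))"
          by (intro integrable_norm Bochner_Integration.integrable_diff i)
        show "integrable circle_measure ?B"
          by (intro integrable_mult_right Bochner_Integration.integrable_sum Bochner_Integration.integrable_add integrable_abs D_int)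
        show "norm (iexp (u \<bullet> S N x) - W N x) \<le> ?B x" for x
        proof -
          have "norm (iexp (u \<bullet> S N x) - W N x) \<le> \<bar>r N * (\<Sum>k = 1..N. u $ 1 * D1 k x + u $ 2 * D2 k x)\<bar>"
            unfolding inner [symmetric] W_def wave_char_def[OF Q_pos] by (rule norm_iexp_diff_le)
          also have "\<dots> = r N * \<bar>\<Sum>k = 1..N. u $ 1 * D1 k x + u $ 2 * D2 k x\<bar>"
            using \<open>r N \<ge> 0\<close> by (simp add: abs_mult)
          also have "\<dots> \<le> ?B x"
          proof (rule mult_left_mono[OF order_trans[OF sum_abs sum_mono] \<open>r N \<ge> 0\<close>])
            show "\<bar>u $ 1 * D1 k x + u $ 2 * D2 k x\<bar> \<le> \<bar>u $ 1\<bar> * \<bar>D1 k x\<bar> + \<bar>u $ 2\<bar> * \<bar>D2 k x\<bar>" for k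
              by (rule order_trans[OF abs_triangle_ineq]) (simp add: abs_mult)
          qed
          finally show ?thesis .
        qed
      qed
      also have "\<dots> = r N * (\<Sum>k = 1..N. \<bar>u $ 1\<bar> * (\<integral>x. \<bar>D1 k x\<bar> \<partial>circle_measure) + \<bar>u $ 2\<bar> * (\<integral>x. \<bar>D2 k x\<bar> \<partial>circle_measure))"
        using D_int by (simp del: space_circle_measure)
      also have "\<dots> \<le> r N * (\<Sum>k = 1..N. \<bar>u $ 1\<bar> * (4 * real k powr (- \<beta>)) + \<bar>u $ 2\<bar> * (4 * real k powr (- \<beta>)))"
        using \<open>r N \<ge> 0\<close> by (intro mult_left_mono sum_mono add_mono D_bound) auto
      also have "\<dots> = r N * (4 * U * (\<Sum>k = 1..N. real k powr (- \<beta>)))"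
        unfolding sum_distrib_left by (intro sum.cong refl) (simp add: U_def algebra_simps)
      also have "\<dots> \<le> r N * (4 * U * Z)"
        unfolding Z_def using \<open>r N \<ge> 0\<close>
        by (intro mult_left_mono sum_powr_le_suminf(1)[OF assms(4)]) (simp_all add: U_def)
      finally show ?thesis by (simp only: mult.commute mult.left_commute mult.assoc)
    qed
    have "r \<longlonglongrightarrow> 0"
      unfolding r_def [abs_def] by (rule tendsto_neg_powr) (auto simp: filterlim_real_sequentially)
    then have "(\<lambda>N. 4 * U * Z * r N) \<longlonglongrightarrow> 0"
      using tendsto_mult_left[of r 0 sequentially "4 * U * Z"] by simp
    then have "(\<lambda>N. (\<integral>x. iexp (u \<bullet> S N x) \<partial>circle_measure) - (\<integral>x. W N x \<partial>circle_measure)) \<longlonglongrightarrow> 0"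
      by (rule Lim_null_comparison[rotated]) (simp add: close)
    moreover have "(\<lambda>N. \<integral>x. W N x \<partial>circle_measure) \<longlonglongrightarrow> of_real (exp (- (((u $ 1)\<^sup>2 + (u $ 2)\<^sup>2) / 2) / 2))"
      unfolding W_def r_def
    proof (rule wave_char_tendsto[OF Q_pos assms(4) gap])
      show "\<bar>v k\<bar> \<le> U" for k by (simp add: v_def U_def)
      show "(\<lambda>N. (\<Sum>k = 1..N. (v k)\<^sup>2) / real N) \<longlonglongrightarrow> ((u $ 1)\<^sup>2 + (u $ 2)\<^sup>2) / 2"
        using assms(8,9) by (intro alternating_average) (simp_all add: v_def P_def)
    qed
    ultimately have "(\<lambda>N. ((\<integral>x. iexp (u \<bullet> S N x) \<partial>circle_measure) - (\<integral>x. W N x \<partial>circle_measure)) + (\<integral>x. W N x \<partial>circle_measure))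
        \<longlonglongrightarrow> 0 + of_real (exp (- (((u $ 1)\<^sup>2 + (u $ 2)\<^sup>2) / 2) / 2))"
      by (rule tendsto_add)
    moreover have "- (y / 2) / 2 = - y / 4" for y :: real by simp
    ultimately show ?thesis by (simp only: diff_add_cancel add_0)
  qed
  have "weakly_converges (\<lambda>N. distr circle_measure borel (S N))
      (centered_gaussian (vector [vector [1/2, 0], vector [0, 1/2]] :: real ^ 2 ^ 2))"
  proof (rule levy_continuity_euclidean)
    show "prob_space (distr circle_measure borel (S N))" for N
      by (rule circle.prob_space_distr[OF S_meas])
    show "(\<lambda>N. \<integral>x. iexp (u \<bullet> x) \<partial>distr circle_measure borel (S N))
        \<longlonglongrightarrow> (\<integral>x. iexp (u \<bullet> x) \<partial>centered_gaussian (vector [vector [1/2, 0], vector [0, 1/2]]))" for u :: "real ^ 2"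
    proof -
      have "(\<integral>x. iexp (u \<bullet> x) \<partial>distr circle_measure borel (S N)) = (\<integral>x. iexp (u \<bullet> S N x) \<partial>circle_measure)" for N
        by (simp add: integral_distr[OF S_meas])
      then show ?thesis unfolding char_centered_gaussian_half by (simp only: char)
    qed
  qed (rule prob_space_centered_gaussian_half, simp, simp add: centered_gaussian_def)
  then have "converges_in_distribution circle_measure S
      (centered_gaussian (vector [vector [1/2, 0], vector [0, 1/2]] :: real ^ 2 ^ 2))"
    unfolding converges_in_distribution_def using S_meas by blast
  then show ?thesis
    unfolding S_def [abs_def] r_def .
qed

end
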